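(* Let $T$ be a complete countable first-order theory with monster model $\mathcal U$ and let $M$ be a countable model of $T$. The following are equivalent: (i) $M$ is eventually NIP. (ii) For every $p(x)\in S(\mathcal U)$ which is finitely satisfiable in $M$, there is a sequence $(c_i)_{i<\omega}$ in $M$ such that $(tp(c_i/\mathcal U))_{i<\omega}$ DBSC-converges to $p$. (iii) For every $p(x)\in S(\mathcal U)$ which is finitely satisfiable in $M$, there is a Morley sequence $(d_i)_{i<\omega}$ of $p$ over $M$ such that $(tp(d_i/\mathcal U))_{i<\omega}$ converges.
   Context: A formula $\phi(x,y)$ (possibly with parameters) is eventually NIP in $M$ if for every infinite sequence $(c_i)$ in $M$ there are a subsequence $(a_i)$ of $(c_i)$, a natural number $n$ and a subset $E\subseteq\{1,\dots,n\}$ such that for all $i_1<\dots<i_n<\omega$, $\mathcal U\models\neg\exists y\big(\bigwedge_{j\in E}\phi(a_{i_j},y)\wedge\bigwedge_{j\in\{1,\dots,n\}\setminus E}\neg\phi(a_{i_j},y)\big)$. $M$ is eventually NIP if every formula is eventually NIP in $M$. A sequence $(a_i)$ in $\mathcal U$ is DBSC-convergent if for every formula $\phi(x,y)$ without parameters there is $N$ such that for every $b\in\mathcal U$, $\sum_{i\ge 1}|\phi(a_i,b)-\phi(a_{i+1},b)|\le N$ (truth values read as $0/1$); $(tp(c_i/\mathcal U))$ DBSC-converges to $p$ means $(c_i)$ is DBSC-convergent and $tp(c_i/\mathcal U)\to p$. Convergence of $(tp(d_i/\mathcal U))$ is in the Stone topology: for each $L(\mathcal U)$-formula $\phi$, the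 truth value of $\phi(d_i)$ is eventually constant, and the limit $p$ satisfies $\phi\in p$ iff $\phi(d_i)$ eventually holds. A Morley sequence of an $M$-invariant global type $p$ over $M$ is $(d_i)$ with $d_i\models p|_{Md_{<i}}$. *)

theory Defs
  imports Complex_Main "HOL-Library.Countable_Set" "HOL-Library.NList"
begin

unbundle cardinal_syntax

section \<open>First-order syntax\<close>

text \<open>A language is a set of function symbols (constants have arity 0) and a set of relation
  symbols. Both sets may be empty.\<close>

record ('f, 'r) lang =
  Funs :: "'f set"
  Rels :: "'r set"
  far :: "'f \<Rightarrow> nat"
  rar :: "'r \<Rightarrow> nat"

definition countable_lang :: "('f, 'r) lang \<Rightarrow> bool" where
  "countable_lang L \<longleftrightarrow> countable (Funs L) \<and> countable (Rels L)"

text \<open>\<open>Par a\<close> is the constant naming the element \<open>a\<close>; thus the \<open>L(A)\<close>-formulas are those whose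
  parameters lie in \<open>A\<close>, and the \<open>L\<close>-formulas those without parameters.\<close>

datatype ('f, tm_params: 'u) tm =
    Var nat
  | Par 'u
  | App 'f "('f, 'u) tm list"

datatype ('f, 'r, fm_params: 'u) fm =
    Eq "('f, 'u) tm" "('f, 'u) tm"
  | Rel 'r "('f, 'u) tm list"
  | Neg "('f, 'r, 'u) fm"
  | Conj "('f, 'r, 'u) fm" "('f, 'r, 'u) fm"
  | Ex nat "('f, 'r, 'u) fm"

primrec fv_tm :: "('f, 'u) tm \<Rightarrow> nat set" where
  "fv_tm (Var v) = {v}"
| "fv_tm (Par a) = {}"
| "fv_tm (App f ts) = \<Union> (set (map fv_tm ts))"

primrec fv :: "('f, 'r, 'u) fm \<Rightarrow> nat set" where
  "fv (Eq s t) = fv_tm s \<union> fv_tm t"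
| "fv (Rel R ts) = \<Union> (set (map fv_tm ts))"
| "fv (Neg \<phi>) = fv \<phi>"
| "fv (Conj \<phi> \<psi>) = fv \<phi> \<union> fv \<psi>"
| "fv (Ex v \<phi>) = fv \<phi> - {v}"

primrec wf_tm :: "('f, 'r) lang \<Rightarrow> ('f, 'u) tm \<Rightarrow> bool" where
  "wf_tm L (Var v) \<longleftrightarrow> True"
| "wf_tm L (Par a) \<longleftrightarrow> True"
| "wf_tm L (App f ts) \<longleftrightarrow> f \<in> Funs L \<and> length ts = far L f \<and> list_all id (map (wf_tm L) ts)"

primrec wf_fm :: "('f, 'r) lang \<Rightarrow> ('f, 'r, 'u) fm \<Rightarrow> bool" where
  "wf_fm L (Eq s t) \<longleftrightarrow> wf_tm L s \<and> wf_tm L t"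
| "wf_fm L (Rel R ts) \<longleftrightarrow> R \<in> Rels L \<and> length ts = rar L R \<and> list_all (wf_tm L) ts"
| "wf_fm L (Neg \<phi>) \<longleftrightarrow> wf_fm L \<phi>"
| "wf_fm L (Conj \<phi> \<psi>) \<longleftrightarrow> wf_fm L \<phi> \<and> wf_fm L \<psi>"
| "wf_fm L (Ex v \<phi>) \<longleftrightarrow> wf_fm L \<phi>"

text \<open>The \<open>L(A)\<close>-formulas with free variables among \<open>v\<^sub>0, \<dots>, v\<^sub>n\<^sub>-\<^sub>1\<close>. A formula \<open>\<phi>(x, y)\<close> with
  \<open>\<bar>x\<bar> = m\<close> and \<open>\<bar>y\<bar> = k\<close> is an element of \<open>form L A (m + k)\<close>, the tuple \<open>x\<close> being the first \<open>m\<close>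
  variables and \<open>y\<close> the following \<open>k\<close>.\<close>

definition form :: "('f, 'r) lang \<Rightarrow> 'u set \<Rightarrow> nat \<Rightarrow> ('f, 'r, 'u) fm set" where
  "form L A n = {\<phi>. wf_fm L \<phi> \<and> fm_params \<phi> \<subseteq> A \<and> fv \<phi> \<subseteq> {..<n}}"


section \<open>Structures and satisfaction\<close>

record ('f, 'r, 'u) struct =
  carr :: "'u set"
  fint :: "'f \<Rightarrow> 'u list \<Rightarrow> 'u"
  rint :: "'r \<Rightarrow> 'u list \<Rightarrow> bool"

definition is_struct :: "('f, 'r) lang \<Rightarrow> ('f, 'r, 'u) struct \<Rightarrow> bool" where
  "is_struct L S \<longleftrightarrow> carr S \<noteq> {} \<and>
     (\<forall>f\<in>Funs L. \<forall>as\<in>nlists (far L f) (carr S). fint S f as \<in> carr S)"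

primrec tm_val :: "('f, 'r, 'u) struct \<Rightarrow> (nat \<Rightarrow> 'u) \<Rightarrow> ('f, 'u) tm \<Rightarrow> 'u" where
  "tm_val S e (Var v) = e v"
| "tm_val S e (Par a) = a"
| "tm_val S e (App f ts) = fint S f (map (tm_val S e) ts)"

primrec sat :: "('f, 'r, 'u) struct \<Rightarrow> (nat \<Rightarrow> 'u) \<Rightarrow> ('f, 'r, 'u) fm \<Rightarrow> bool" where
  "sat S e (Eq s t) \<longleftrightarrow> tm_val S e s = tm_val S e t"
| "sat S e (Rel R ts) \<longleftrightarrow> rint S R (map (tm_val S e) ts)"
| "sat S e (Neg \<phi>) \<longleftrightarrow> \<not> sat S e \<phi>"
| "sat S e (Conj \<phi> \<psi>) \<longleftrightarrow> sat S e \<phi> \<and> sat S e \<psi>"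
| "sat S e (Ex v \<phi>) \<longleftrightarrow> (\<exists>a\<in>carr S. sat S (e(v := a)) \<phi>)"

text \<open>\<open>S \<Turnstile> \<phi>(as)\<close>. Only used for \<open>\<phi> \<in> form L A (length as)\<close>, so that the values of \<open>(!) as\<close> beyond
  the length of \<open>as\<close> are irrelevant.\<close>

definition holds :: "('f, 'r, 'u) struct \<Rightarrow> ('f, 'r, 'u) fm \<Rightarrow> 'u list \<Rightarrow> bool" where
  "holds S \<phi> as \<longleftrightarrow> sat S (\<lambda>i. as ! i) \<phi>"


section \<open>Theories, elementary substructures, monster models\<close>

definition models :: "('f, 'r) lang \<Rightarrow> ('f, 'r, 'u) struct \<Rightarrow> ('f, 'r, 'u) fm set \<Rightarrow> bool" where
  "models L S T \<longleftrightarrow> is_struct L S \<and> (\<forall>\<phi>\<in>T. holds S \<phi> [])"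

text \<open>HOL can quantify only over the models whose carrier lies in the given type \<open>'u\<close>.\<close>

definition entails :: "('f, 'r) lang \<Rightarrow> ('f, 'r, 'u) fm set \<Rightarrow> ('f, 'r, 'u) fm \<Rightarrow> bool" where
  "entails L T \<phi> \<longleftrightarrow> (\<forall>S. models L S T \<longrightarrow> holds S \<phi> [])"

definition complete_theory :: "('f, 'r) lang \<Rightarrow> ('f, 'r, 'u) fm set \<Rightarrow> bool" where
  "complete_theory L T \<longleftrightarrow> T \<subseteq> form L {} 0 \<and> (\<exists>S. models L S T) \<and>
     (\<forall>\<phi>\<in>form L {} 0. entails L T \<phi> \<or> entails L T (Neg \<phi>))"

definition substructure ::
  "('f, 'r) lang \<Rightarrow> ('f, 'r, 'u) struct \<Rightarrow> ('f, 'r, 'u) struct \<Rightarrow> bool" where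
  "substructure L M U \<longleftrightarrow> is_struct L M \<and> is_struct L U \<and> carr M \<subseteq> carr U \<and>
     (\<forall>f\<in>Funs L. \<forall>as\<in>nlists (far L f) (carr M). fint M f as = fint U f as) \<and>
     (\<forall>R\<in>Rels L. \<forall>as\<in>nlists (rar L R) (carr M). rint M R as = rint U R as)"

definition elementary_substructure ::
  "('f, 'r) lang \<Rightarrow> ('f, 'r, 'u) struct \<Rightarrow> ('f, 'r, 'u) struct \<Rightarrow> bool" where
  "elementary_substructure L M U \<longleftrightarrow> substructure L M U \<and>
     (\<forall>n. \<forall>\<phi>\<in>form L {} n. \<forall>as\<in>nlists n (carr M). holds M \<phi> as \<longleftrightarrow> holds U \<phi> as)"

definition fin_sat ::
  "('f, 'r, 'u) struct \<Rightarrow> 'u set \<Rightarrow> nat \<Rightarrow> ('f, 'r, 'u) fm set \<Rightarrow> bool" where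
  "fin_sat U A n \<Gamma> \<longleftrightarrow>
     (\<forall>\<Delta>. finite \<Delta> \<and> \<Delta> \<subseteq> \<Gamma> \<longrightarrow> (\<exists>as\<in>nlists n A. \<forall>\<phi>\<in>\<Delta>. holds U \<phi> as))"

definition saturated :: "'k rel \<Rightarrow> ('f, 'r) lang \<Rightarrow> ('f, 'r, 'u) struct \<Rightarrow> bool" where
  "saturated \<kappa> L U \<longleftrightarrow>
     (\<forall>A n \<Gamma>. A \<subseteq> carr U \<and> |A| <o \<kappa> \<and> \<Gamma> \<subseteq> form L A n \<and> fin_sat U (carr U) n \<Gamma> \<longrightarrow>
        (\<exists>as\<in>nlists n (carr U). \<forall>\<phi>\<in>\<Gamma>. holds U \<phi> as))"

definition automorphism :: "('f, 'r) lang \<Rightarrow> ('f, 'r, 'u) struct \<Rightarrow> ('u \<Rightarrow> 'u) \<Rightarrow> bool" where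
  "automorphism L U \<sigma> \<longleftrightarrow> bij_betw \<sigma> (carr U) (carr U) \<and>
     (\<forall>f\<in>Funs L. \<forall>as\<in>nlists (far L f) (carr U). \<sigma> (fint U f as) = fint U f (map \<sigma> as)) \<and>
     (\<forall>R\<in>Rels L. \<forall>as\<in>nlists (rar L R) (carr U). rint U R (map \<sigma> as) = rint U R as)"

definition elementary_map ::
  "('f, 'r) lang \<Rightarrow> ('f, 'r, 'u) struct \<Rightarrow> 'u set \<Rightarrow> ('u \<Rightarrow> 'u) \<Rightarrow> bool" where
  "elementary_map L U A g \<longleftrightarrow> g ` A \<subseteq> carr U \<and>
     (\<forall>n. \<forall>\<phi>\<in>form L {} n. \<forall>as\<in>nlists n A. holds U \<phi> as \<longleftrightarrow> holds U \<phi> (map g as))"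

definition strongly_homogeneous :: "'k rel \<Rightarrow> ('f, 'r) lang \<Rightarrow> ('f, 'r, 'u) struct \<Rightarrow> bool" where
  "strongly_homogeneous \<kappa> L U \<longleftrightarrow>
     (\<forall>A g. A \<subseteq> carr U \<and> |A| <o \<kappa> \<and> elementary_map L U A g \<longrightarrow>
        (\<exists>\<sigma>. automorphism L U \<sigma> \<and> (\<forall>a\<in>A. \<sigma> a = g a)))"

text \<open>Uncountability of \<open>\<kappa>\<close> is the minimal largeness requirement for a countable language; a larger
  \<open>\<kappa>\<close> only makes the notion more restrictive.\<close>

definition monster_model ::
  "'k rel \<Rightarrow> ('f, 'r) lang \<Rightarrow> ('f, 'r, 'u) fm set \<Rightarrow> ('f, 'r, 'u) struct \<Rightarrow> bool" where
  "monster_model \<kappa> L T U \<longleftrightarrow> models L U T \<and> Card_order \<kappa> \<and> natLeq <o \<kappa> \<and>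
     saturated \<kappa> L U \<and> strongly_homogeneous \<kappa> L U"


section \<open>Types\<close>

text \<open>The complete \<open>n\<close>-types over \<open>A\<close>; the space of global types in an \<open>n\<close>-tuple of variables is
  \<open>types L U (carr U) n\<close>.\<close>

definition types ::
  "('f, 'r) lang \<Rightarrow> ('f, 'r, 'u) struct \<Rightarrow> 'u set \<Rightarrow> nat \<Rightarrow> ('f, 'r, 'u) fm set set" where
  "types L U A n = {p. p \<subseteq> form L A n \<and> fin_sat U (carr U) n p \<and>
     (\<forall>\<phi>\<in>form L A n. \<phi> \<in> p \<or> Neg \<phi> \<in> p)}"

text \<open>\<open>map_fm id id \<sigma> \<phi>\<close> replaces every parameter \<open>a\<close> of \<open>\<phi>\<close> by \<open>\<sigma> a\<close>.\<close>

definition invariant_type ::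
  "('f, 'r) lang \<Rightarrow> ('f, 'r, 'u) struct \<Rightarrow> 'u set \<Rightarrow> nat \<Rightarrow> ('f, 'r, 'u) fm set \<Rightarrow> bool" where
  "invariant_type L U A n p \<longleftrightarrow>
     (\<forall>\<sigma>. automorphism L U \<sigma> \<and> (\<forall>a\<in>A. \<sigma> a = a) \<longrightarrow>
        (\<forall>\<phi>\<in>form L (carr U) n. \<phi> \<in> p \<longleftrightarrow> map_fm id id \<sigma> \<phi> \<in> p))"

definition morley_sequence ::
  "('f, 'r) lang \<Rightarrow> ('f, 'r, 'u) struct \<Rightarrow> 'u set \<Rightarrow> nat \<Rightarrow> ('f, 'r, 'u) fm set \<Rightarrow>
   (nat \<Rightarrow> 'u list) \<Rightarrow> bool" where
  "morley_sequence L U A n p d \<longleftrightarrow> invariant_type L U A n p \<and>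
     (\<forall>i. d i \<in> nlists n (carr U) \<and>
        (\<forall>\<phi>\<in>p \<inter> form L (A \<union> (\<Union>j<i. set (d j))) n. holds U \<phi> (d i)))"

text \<open>Convergence of \<open>(tp(d\<^sub>i/U))\<close> in the Stone topology.\<close>

definition tp_convergent ::
  "('f, 'r) lang \<Rightarrow> ('f, 'r, 'u) struct \<Rightarrow> nat \<Rightarrow> (nat \<Rightarrow> 'u list) \<Rightarrow> bool" where
  "tp_convergent L U n d \<longleftrightarrow>
     (\<forall>\<phi>\<in>form L (carr U) n.
        (\<forall>\<^sub>F i in sequentially. holds U \<phi> (d i)) \<or> (\<forall>\<^sub>F i in sequentially. \<not> holds U \<phi> (d i)))"

definition tp_converges_to ::
  "('f, 'r) lang \<Rightarrow> ('f, 'r, 'u) struct \<Rightarrow> nat \<Rightarrow> (nat \<Rightarrow> 'u list) \<Rightarrow> ('f, 'r, 'u) fm set \<Rightarrow> bool"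
  where
  "tp_converges_to L U n d p \<longleftrightarrow> tp_convergent L U n d \<and>
     (\<forall>\<phi>\<in>form L (carr U) n. \<phi> \<in> p \<longleftrightarrow> (\<forall>\<^sub>F i in sequentially. holds U \<phi> (d i)))"

definition dbsc_convergent ::
  "('f, 'r) lang \<Rightarrow> ('f, 'r, 'u) struct \<Rightarrow> nat \<Rightarrow> (nat \<Rightarrow> 'u list) \<Rightarrow> bool" where
  "dbsc_convergent L U n a \<longleftrightarrow>
     (\<forall>k. \<forall>\<phi>\<in>form L {} (n + k). \<exists>N :: nat. \<forall>b\<in>nlists k (carr U).
        summable (\<lambda>i. \<bar>of_bool (holds U \<phi> (a i @ b)) - of_bool (holds U \<phi> (a (Suc i) @ b))\<bar> :: real) \<and>
        (\<Sum>i. \<bar>of_bool (holds U \<phi> (a i @ b)) - of_bool (holds U \<phi> (a (Suc i) @ b))\<bar>) \<le> real N)"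

definition dbsc_converges_to ::
  "('f, 'r) lang \<Rightarrow> ('f, 'r, 'u) struct \<Rightarrow> nat \<Rightarrow> (nat \<Rightarrow> 'u list) \<Rightarrow> ('f, 'r, 'u) fm set \<Rightarrow> bool"
  where
  "dbsc_converges_to L U n c p \<longleftrightarrow> dbsc_convergent L U n c \<and> tp_converges_to L U n c p"


section \<open>Eventual NIP\<close>

text \<open>The formula \<open>\<phi>(x, y)\<close> has \<open>\<bar>x\<bar> = m\<close> and \<open>\<bar>y\<bar> = k\<close>; \<open>A\<close> is the carrier of the small model. The
  subsequence is \<open>c \<circ> s\<close>, and \<open>i\<close> enumerates the indices \<open>i\<^sub>1 < \<dots> < i\<^sub>n\<close>.\<close>

definition eventually_nip_formula ::
  "('f, 'r, 'u) struct \<Rightarrow> 'u set \<Rightarrow> nat \<Rightarrow> nat \<Rightarrow> ('f, 'r, 'u) fm \<Rightarrow> bool" where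
  "eventually_nip_formula U A m k \<phi> \<longleftrightarrow>
     (\<forall>c :: nat \<Rightarrow> 'u list. (\<forall>i. c i \<in> nlists m A) \<longrightarrow>
        (\<exists>s :: nat \<Rightarrow> nat. strict_mono s \<and>
          (\<exists>n. \<exists>E\<subseteq>{1..n}. \<forall>i :: nat \<Rightarrow> nat. strict_mono_on {1..n} i \<longrightarrow>
             \<not> (\<exists>y\<in>nlists k (carr U).
                   (\<forall>j\<in>E. holds U \<phi> (c (s (i j)) @ y)) \<and>
                   (\<forall>j\<in>{1..n} - E. \<not> holds U \<phi> (c (s (i j)) @ y))))))"

definition eventually_nip ::
  "('f, 'r) lang \<Rightarrow> ('f, 'r, 'u) struct \<Rightarrow> 'u set \<Rightarrow> bool" where
  "eventually_nip L U A \<longleftrightarrow>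
     (\<forall>m k. \<forall>\<phi>\<in>form L (carr U) (m + k). eventually_nip_formula U A m k \<phi>)"

end

theory Submission
  imports Defs "HOL-Library.Countable_Set_Type"
begin

text \<open>A Morley sequence \<open>(d\<^sub>i)\<close> of \<open>p\<close> can be traded for elements of \<open>M\<close> from the right: if
  \<open>\<theta>(d\<^sub>1, \<dots>, d\<^sub>r)\<close> holds with \<open>\<theta>\<close> over \<open>M\<close>, then \<open>\<theta>(d\<^sub>1, \<dots>, d\<^sub>r\<^sub>-\<^sub>1, x)\<close> lies in \<open>p\<close>, so it
  holds of some \<open>c \<in> M\<close>, and one continues with \<open>\<theta>(x\<^sub>1, \<dots>, x\<^sub>r\<^sub>-\<^sub>1, c)\<close>. Here \<open>c\<close> may be chosen from
  any sequence in \<open>M\<close> whose types converge to \<open>p\<close> over the Morley sequence. Applied to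
  \<open>\<exists>y. \<And>\<^sub>j \<phi>(x\<^sub>j, y)\<^bsup>E(j)\<^esup>\<close>, this carries every pattern of a non-convergent Morley sequence over to
  such a sequence in \<open>M\<close>, contradicting both eventual NIP and DBSC-convergence.

  Conversely, if \<open>(d\<^sub>i)\<close> converges, then by saturation some \<open>r\<close> bounds the alternations of
  \<open>\<phi>(x, b)\<close> on \<open>d\<^sub>1, \<dots>, d\<^sub>r\<close> uniformly in \<open>b\<close>. A sufficiently sparse sequence in \<open>M\<close> inherits,
  from some index on, this property of the reversed tuple. Thinning out an enumeration of \<open>M\<close> in
  this way gives a DBSC-convergent sequence; thinning out an arbitrary sequence \<open>(c\<^sub>i)\<close>, with \<open>p\<close> an
  accumulation point of its types, gives eventual NIP.\<close>

text \<open>The simplification rules of \<^theory>\<open>HOL-Library.NList\<close> do not terminate together with the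
  definition of \<^const>\<open>nlists\<close>.\<close>

declare nlistsE_length [simp del] nlistsE_set [simp del]

lemma in_nlists_iff [simp]: "xs \<in> nlists n A \<longleftrightarrow> length xs = n \<and> set xs \<subseteq> A"
  by (simp add: nlists_def)

section \<open>Substitution\<close>

text \<open>Parameters are substituted together with variables: form_plug turns variables into
  parameters, form_separate_params goes the other way.\<close>

primrec inst_tm :: "(nat \<Rightarrow> ('f, 'u) tm) \<Rightarrow> ('u \<Rightarrow> ('f, 'u) tm) \<Rightarrow> ('f, 'u) tm \<Rightarrow> ('f, 'u) tm" where
  "inst_tm \<rho> \<pi> (Var v) = \<rho> v"
| "inst_tm \<rho> \<pi> (Par a) = \<pi> a"
| "inst_tm \<rho> \<pi> (App f ts) = App f (map (inst_tm \<rho> \<pi>) ts)"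

text \<open>Capture is avoided by renaming the bound variables to \<open>v\<^sub>n, v\<^sub>n\<^sub>+\<^sub>1, \<dots>\<close>, where all variables
  in the substituted terms lie below \<open>n\<close>.\<close>

primrec inst ::
  "('f, 'r, 'u) fm \<Rightarrow> nat \<Rightarrow> (nat \<Rightarrow> ('f, 'u) tm) \<Rightarrow> ('u \<Rightarrow> ('f, 'u) tm) \<Rightarrow> ('f, 'r, 'u) fm" where
  "inst (Eq s t) = (\<lambda>n \<rho> \<pi>. Eq (inst_tm \<rho> \<pi> s) (inst_tm \<rho> \<pi> t))"
| "inst (Rel R ts) = (\<lambda>n \<rho> \<pi>. Rel R (map (inst_tm \<rho> \<pi>) ts))"
| "inst (Neg \<phi>) = (\<lambda>n \<rho> \<pi>. Neg (inst \<phi> n \<rho> \<pi>))"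
| "inst (Conj \<phi> \<psi>) = (\<lambda>n \<rho> \<pi>. Conj (inst \<phi> n \<rho> \<pi>) (inst \<psi> n \<rho> \<pi>))"
| "inst (Ex v \<phi>) = (\<lambda>n \<rho> \<pi>. Ex n (inst \<phi> (Suc n) (\<rho>(v := Var n)) \<pi>))"

lemma tm_val_cong: "(\<And>v. v \<in> fv_tm t \<Longrightarrow> e v = e' v) \<Longrightarrow> tm_val S e t = tm_val S e' t"
proof (induction t)
  case (App f ts)
  then have "map (tm_val S e) ts = map (tm_val S e') ts"
    by (intro map_cong refl App.IH) auto
  then show ?case by (simp only: tm_val.simps)
qed auto

lemma sat_cong: "(\<And>v. v \<in> fv \<phi> \<Longrightarrow> e v = e' v) \<Longrightarrow> sat S e \<phi> \<longleftrightarrow> sat S e' \<phi>"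
proof (induction \<phi> arbitrary: e e')
  case (Eq s t)
  then have "tm_val S e s = tm_val S e' s" "tm_val S e t = tm_val S e' t"
    by (auto intro: tm_val_cong)
  then show ?case by simp
next
  case (Rel R ts)
  then have "map (tm_val S e) ts = map (tm_val S e') ts"
    by (auto intro!: tm_val_cong)
  then show ?case by (simp del: map_eq_conv)
next
  case (Neg \<phi>)
  have "sat S e \<phi> = sat S e' \<phi>"
    by (rule Neg.IH) (use Neg.prems in simp)
  then show ?case by simp
next
  case (Conj \<phi> \<psi>)
  then have "sat S e \<phi> = sat S e' \<phi>" "sat S e \<psi> = sat S e' \<psi>"
    by (metis UnI1 fv.simps(4)) (metis Conj UnI2 fv.simps(4))
  then show ?case by simp
next
  case (Ex v \<phi>)
  have "sat S (e(v := a)) \<phi> = sat S (e'(v := a)) \<phi>" for a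
    by (rule Ex.IH) (use Ex.prems in auto)
  then show ?case by simp
qed

lemma holds_cong:
  "(\<And>v. v \<in> fv \<phi> \<Longrightarrow> e v = as ! v) \<Longrightarrow> sat S e \<phi> \<longleftrightarrow> holds S \<phi> as"
  unfolding holds_def by (rule sat_cong)

lemma tm_val_inst_tm:
  "(\<And>a. a \<in> tm_params t \<Longrightarrow> tm_val S e (\<pi> a) = a) \<Longrightarrow>
     tm_val S e (inst_tm \<rho> \<pi> t) = tm_val S (\<lambda>v. tm_val S e (\<rho> v)) t"
proof (induction t)
  case (App f ts)
  then have "map (\<lambda>t. tm_val S e (inst_tm \<rho> \<pi> t)) ts = map (tm_val S (\<lambda>v. tm_val S e (\<rho> v))) ts"
    by (intro map_cong refl App.IH) auto
  then show ?case by (simp add: comp_def del: map_eq_conv)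
qed auto

text \<open>The usual substitution lemma; on the parameter side it needs that \<open>\<pi> a\<close>
  still evaluates to \<open>a\<close>, since the original formula reads \<open>a\<close> as
  itself.\<close>

lemma sat_inst:
  fixes \<phi> :: "('f, 'r, 'u) fm" and \<rho> :: "nat \<Rightarrow> ('f, 'u) tm"
  assumes "\<And>v. v \<in> fv \<phi> \<Longrightarrow> fv_tm (\<rho> v) \<subseteq> {..<n}"
    and "\<And>a. a \<in> fm_params \<phi> \<Longrightarrow> fv_tm (\<pi> a) \<subseteq> {..<n} \<and> tm_val S e (\<pi> a) = a"
  shows "sat S e (inst \<phi> n \<rho> \<pi>) \<longleftrightarrow> sat S (\<lambda>v. tm_val S e (\<rho> v)) \<phi>"
  using assms
proof (induction \<phi> arbitrary: n \<rho> e)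
  case (Rel R ts)
  then have "map (tm_val S e \<circ> inst_tm \<rho> \<pi>) ts = map (tm_val S (\<lambda>v. tm_val S e (\<rho> v))) ts"
    by (auto intro!: tm_val_inst_tm)
  then show ?case by (simp del: map_eq_conv)
next
  case (Ex v \<phi>)
  \<comment> \<open>The renamed bound variable \<open>n\<close> lies above every variable of the
    substituted terms, so assigning a witness to it leaves their values alone.\<close>
  have upd: "tm_val S (e(n := a)) t = tm_val S e t" if "fv_tm t \<subseteq> {..<n}" for a t
    using that by (intro tm_val_cong) auto
  have "sat S (e(n := a)) (inst \<phi> (Suc n) (\<rho>(v := Var n)) \<pi>) =
        sat S (\<lambda>u. tm_val S (e(n := a)) ((\<rho>(v := Var n)) u)) \<phi>" for a
  proof (rule Ex.IH)
    show "fv_tm ((\<rho>(v := Var n)) u) \<subseteq> {..<Suc n}" if "u \<in> fv \<phi>" for u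
      using Ex.prems(1)[of u] that by (cases "u = v") (auto simp: less_Suc_eq)
    show "fv_tm (\<pi> b) \<subseteq> {..<Suc n} \<and> tm_val S (e(n := a)) (\<pi> b) = b" if "b \<in> fm_params \<phi>" for b
    proof -
      have "fv_tm (\<pi> b) \<subseteq> {..<n}" "tm_val S e (\<pi> b) = b"
        using Ex.prems(2)[of b] that by auto
      then show ?thesis using upd[of "\<pi> b" a] by (auto simp: less_Suc_eq)
    qed
  qed
  moreover have "sat S (\<lambda>u. tm_val S (e(n := a)) ((\<rho>(v := Var n)) u)) \<phi> =
      sat S ((\<lambda>u. tm_val S e (\<rho> u))(v := a)) \<phi>" for a
    by (rule sat_cong) (use Ex.prems(1) upd in auto)
  ultimately show ?case by simp
qed (auto simp: tm_val_inst_tm)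

lemma wf_inst_tm:
  "(\<And>v. v \<in> fv_tm t \<Longrightarrow> wf_tm L (\<rho> v)) \<Longrightarrow> (\<And>a. a \<in> tm_params t \<Longrightarrow> wf_tm L (\<pi> a)) \<Longrightarrow>
    wf_tm L t \<Longrightarrow> wf_tm L (inst_tm \<rho> \<pi> t)"
proof (induction t)
  case (App f ts)
  have "wf_tm L (inst_tm \<rho> \<pi> t)" if "t \<in> set ts" for t
    by (rule App.IH) (use that App.prems in \<open>auto simp: list_all_iff\<close>)
  then show ?case using App.prems(3) by (simp add: list_all_iff)
qed auto

lemma fv_inst_tm:
  "(\<And>v. v \<in> fv_tm t \<Longrightarrow> fv_tm (\<rho> v) \<subseteq> B) \<Longrightarrow> (\<And>a. a \<in> tm_params t \<Longrightarrow> fv_tm (\<pi> a) \<subseteq> B) \<Longrightarrow>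
    fv_tm (inst_tm \<rho> \<pi> t) \<subseteq> B"
proof (induction t)
  case (App f ts)
  have "fv_tm (inst_tm \<rho> \<pi> t) \<subseteq> B" if "t \<in> set ts" for t
    by (rule App.IH) (use that App.prems in auto)
  then show ?case by auto
qed auto

lemma params_inst_tm:
  "(\<And>v. v \<in> fv_tm t \<Longrightarrow> tm_params (\<rho> v) \<subseteq> B) \<Longrightarrow> (\<And>a. a \<in> tm_params t \<Longrightarrow> tm_params (\<pi> a) \<subseteq> B) \<Longrightarrow>
    tm_params (inst_tm \<rho> \<pi> t) \<subseteq> B"
proof (induction t)
  case (App f ts)
  have "tm_params (inst_tm \<rho> \<pi> t) \<subseteq> B" if "t \<in> set ts" for t
    by (rule App.IH) (use that App.prems in auto)
  then show ?case by auto
qed auto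

text \<open>The number \<open>n\<close> has two roles: it is the first name for bound variables and
  the bound on the free variables of the result. Quantifying the variable \<open>n\<close> away
  again reconciles both in the case of \<open>Ex\<close>.\<close>

lemma inst_in_form:
  fixes L :: "('f, 'r) lang" and \<phi> :: "('f, 'r, 'u) fm" and \<rho> :: "nat \<Rightarrow> ('f, 'u) tm"
  assumes "wf_fm L \<phi>"
    and "\<And>v. v \<in> fv \<phi> \<Longrightarrow> wf_tm L (\<rho> v) \<and> fv_tm (\<rho> v) \<subseteq> {..<n} \<and> tm_params (\<rho> v) \<subseteq> B"
    and "\<And>a. a \<in> fm_params \<phi> \<Longrightarrow> wf_tm L (\<pi> a) \<and> fv_tm (\<pi> a) \<subseteq> {..<n} \<and> tm_params (\<pi> a) \<subseteq> B"
  shows "inst \<phi> n \<rho> \<pi> \<in> form L B n"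
  using assms
proof (induction \<phi> arbitrary: n \<rho>)
  case (Eq s t)
  then show ?case
    by (simp add: form_def wf_inst_tm fv_inst_tm params_inst_tm)
next
  case (Rel R ts)
  have "wf_tm L (inst_tm \<rho> \<pi> t) \<and> fv_tm (inst_tm \<rho> \<pi> t) \<subseteq> {..<n} \<and> tm_params (inst_tm \<rho> \<pi> t) \<subseteq> B"
    if "t \<in> set ts" for t
  proof -
    have \<rho>: "wf_tm L (\<rho> v) \<and> fv_tm (\<rho> v) \<subseteq> {..<n} \<and> tm_params (\<rho> v) \<subseteq> B" if "v \<in> fv_tm t" for v
      by (rule Rel.prems(2)) (use \<open>t \<in> set ts\<close> that in auto)
    have \<pi>: "wf_tm L (\<pi> a) \<and> fv_tm (\<pi> a) \<subseteq> {..<n} \<and> tm_params (\<pi> a) \<subseteq> B" if "a \<in> tm_params t" for a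
      by (rule Rel.prems(3)) (use \<open>t \<in> set ts\<close> that in auto)
    have "wf_tm L t" using Rel.prems(1) that by (simp add: list_all_iff)
    then show ?thesis
      using \<rho> \<pi> by (intro conjI wf_inst_tm fv_inst_tm params_inst_tm) auto
  qed
  then show ?case using Rel.prems(1) by (auto simp: form_def list_all_iff)
next
  case (Neg \<phi>)
  then show ?case by (simp add: form_def)
next
  case (Conj \<phi> \<psi>)
  then show ?case by (simp add: form_def)
next
  case (Ex v \<phi>)
  have "inst \<phi> (Suc n) (\<rho>(v := Var n)) \<pi> \<in> form L B (Suc n)"
  proof (rule Ex.IH)
    show "wf_fm L \<phi>" using Ex.prems(1) by simp
    show "wf_tm L ((\<rho>(v := Var n)) u) \<and> fv_tm ((\<rho>(v := Var n)) u) \<subseteq> {..<Suc n} \<and>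
      tm_params ((\<rho>(v := Var n)) u) \<subseteq> B" if "u \<in> fv \<phi>" for u
      using Ex.prems(2)[of u] that by (cases "u = v") (auto simp: less_Suc_eq)
    show "wf_tm L (\<pi> a) \<and> fv_tm (\<pi> a) \<subseteq> {..<Suc n} \<and> tm_params (\<pi> a) \<subseteq> B"
      if "a \<in> fm_params \<phi>" for a
      using Ex.prems(3)[of a] that by (auto simp: less_Suc_eq)
  qed
  then show ?case by (fastforce simp: form_def)
qed

lemma finite_tm_params: "finite (tm_params t)"
  by (induction t) auto

lemma finite_fm_params: "finite (fm_params \<phi>)"
  by (induction \<phi>) (auto simp: finite_tm_params)

lemma form_mono: "A \<subseteq> B \<Longrightarrow> form L A n \<subseteq> form L B n"
  by (auto simp: form_def)

lemma Neg_in_form [simp]: "Neg \<phi> \<in> form L A n \<longleftrightarrow> \<phi> \<in> form L A n"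
  by (simp add: form_def)

lemma Conj_in_form [simp]: "Conj \<phi> \<psi> \<in> form L A n \<longleftrightarrow> \<phi> \<in> form L A n \<and> \<psi> \<in> form L A n"
  by (auto simp: form_def)

lemma holds_Neg [simp]: "holds S (Neg \<phi>) as \<longleftrightarrow> \<not> holds S \<phi> as"
  by (simp add: holds_def)

lemma holds_Conj [simp]: "holds S (Conj \<phi> \<psi>) as \<longleftrightarrow> holds S \<phi> as \<and> holds S \<psi> as"
  by (simp add: holds_def)

text \<open>Used to read a formula in several blocks as a formula in the middle block alone, which
  can then be compared with a type; the outer blocks become parameters and the middle variables are
  shifted down.\<close>

lemma form_plug:
  fixes L :: "('f, 'r) lang" and \<phi> :: "('f, 'r, 'u) fm"
  assumes "\<phi> \<in> form L A (length a + n + length b)" and "set a \<union> set b \<union> A \<subseteq> B"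
  obtains \<theta> where "\<theta> \<in> form L B n"
    "\<And>S x. length x = n \<Longrightarrow> holds S \<theta> x \<longleftrightarrow> holds S \<phi> (a @ x @ b)"
proof
  define \<rho> :: "nat \<Rightarrow> ('f, 'u) tm" where "\<rho> v = (if v < length a then Par (a ! v)
    else if v < length a + n then Var (v - length a) else Par (b ! (v - length a - n)))" for v
  have fv: "v < length a + n + length b" if "v \<in> fv \<phi>" for v
    using assms(1) that by (auto simp: form_def)
  have "v - length a - n < length b" if "v \<in> fv \<phi>" "\<not> v < length a" "\<not> v < length a + n" for v
    using fv that by fastforce
  then have mem: "b ! (v - length a - n) \<in> B" if "v \<in> fv \<phi>" "\<not> v < length a" "\<not> v < length a + n" for v
    using that assms(2) by (meson UnCI nth_mem subsetD)
  show "inst \<phi> n \<rho> Par \<in> form L B n"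
  proof (rule inst_in_form)
    show "wf_fm L \<phi>" using assms(1) by (simp add: form_def)
    show "wf_tm L (\<rho> v) \<and> fv_tm (\<rho> v) \<subseteq> {..<n} \<and> tm_params (\<rho> v) \<subseteq> B" if "v \<in> fv \<phi>" for v
      using that mem assms(2) by (auto simp: \<rho>_def)
    show "wf_tm L (Par c) \<and> fv_tm (Par c) \<subseteq> {..<n} \<and> tm_params (Par c) \<subseteq> B"
      if "c \<in> fm_params \<phi>" for c
      using that assms by (auto simp: form_def)
  qed
  show "holds S (inst \<phi> n \<rho> Par) x \<longleftrightarrow> holds S \<phi> (a @ x @ b)" if "length x = n" for S x
  proof -
    have "holds S (inst \<phi> n \<rho> Par) x \<longleftrightarrow> sat S (\<lambda>v. tm_val S ((!) x) (\<rho> v)) \<phi>"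
      unfolding holds_def by (rule sat_inst) (auto simp: \<rho>_def)
    also have "\<dots> \<longleftrightarrow> holds S \<phi> (a @ x @ b)"
      using that by (intro holds_cong) (auto simp: \<rho>_def nth_append)
    finally show ?thesis .
  qed
qed

lemma form_rename:
  assumes "\<phi> \<in> form L A m" and "\<And>v. v < m \<Longrightarrow> f v < n"
  obtains \<theta> where "\<theta> \<in> form L A n"
    "\<And>S x y. length x = m \<Longrightarrow> (\<And>v. v < m \<Longrightarrow> y ! f v = x ! v) \<Longrightarrow> holds S \<theta> y \<longleftrightarrow> holds S \<phi> x"
proof
  have fv: "v < m" if "v \<in> fv \<phi>" for v
    using assms(1) that by (auto simp: form_def)
  show "inst \<phi> n (\<lambda>v. Var (f v)) Par \<in> form L A n"
    using assms by (intro inst_in_form) (auto simp: form_def)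
  show "holds S (inst \<phi> n (\<lambda>v. Var (f v)) Par) y \<longleftrightarrow> holds S \<phi> x"
    if "length x = m" "\<And>v. v < m \<Longrightarrow> y ! f v = x ! v" for S x y
  proof -
    have "holds S (inst \<phi> n (\<lambda>v. Var (f v)) Par) y \<longleftrightarrow>
        sat S (\<lambda>v. tm_val S ((!) y) (Var (f v))) \<phi>"
      unfolding holds_def using assms fv by (intro sat_inst) auto
    also have "\<dots> \<longleftrightarrow> holds S \<phi> x"
      using that fv by (intro holds_cong) auto
    finally show ?thesis .
  qed
qed

text \<open>Links convergence, which speaks of formulas over the monster model, with
  DBSC-convergence and patterns, which speak of formulas without parameters: the parameters are
  listed in \<open>b\<close> and become the last variables.\<close>

lemma form_separate_params:
  assumes "\<phi> \<in> form L A n"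
  obtains k b \<phi>\<^sub>0 where "b \<in> nlists k A" "\<phi>\<^sub>0 \<in> form L {} (n + k)"
    "\<And>S x. length x = n \<Longrightarrow> holds S \<phi>\<^sub>0 (x @ b) \<longleftrightarrow> holds S \<phi> x"
proof -
  obtain b where b: "set b = fm_params \<phi>" "distinct b"
    using finite_distinct_list[OF finite_fm_params] by metis
  define ix where "ix a = (SOME i. i < length b \<and> b ! i = a)" for a
  have ix: "ix a < length b \<and> b ! ix a = a" if "a \<in> fm_params \<phi>" for a
    unfolding ix_def by (rule someI_ex) (use that b in \<open>metis in_set_conv_nth\<close>)
  have fv: "v < n" if "v \<in> fv \<phi>" for v
    using assms that by (auto simp: form_def)
  let ?\<phi> = "inst \<phi> (n + length b) Var (\<lambda>a. Var (n + ix a))"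
  show thesis
  proof (rule that[of b "length b" ?\<phi>])
    show "b \<in> nlists (length b) A"
      using assms b(1) by (auto simp: form_def)
    show "?\<phi> \<in> form L {} (n + length b)"
    proof (rule inst_in_form)
      show "wf_fm L \<phi>" using assms by (simp add: form_def)
    next
      fix v assume "v \<in> fv \<phi>"
      then show "wf_tm L (Var v) \<and> fv_tm (Var v) \<subseteq> {..<n + length b} \<and> tm_params (Var v) \<subseteq> {}"
        using fv[of v] by simp
    next
      fix a assume "a \<in> fm_params \<phi>"
      then show "wf_tm L (Var (n + ix a)) \<and> fv_tm (Var (n + ix a)) \<subseteq> {..<n + length b} \<and>
          tm_params (Var (n + ix a)) \<subseteq> {}"
        using ix[of a] by simp
    qed
    show "holds S ?\<phi> (x @ b) \<longleftrightarrow> holds S \<phi> x" if "length x = n" for S x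
    proof -
      have "holds S ?\<phi> (x @ b) \<longleftrightarrow> sat S (\<lambda>v. tm_val S ((!) (x @ b)) (Var v)) \<phi>"
        unfolding holds_def
      proof (rule sat_inst)
        fix v assume "v \<in> fv \<phi>"
        then show "fv_tm (Var v) \<subseteq> {..<n + length b}"
          using fv[of v] by simp
      next
        fix a assume "a \<in> fm_params \<phi>"
        then show "fv_tm (Var (n + ix a)) \<subseteq> {..<n + length b} \<and>
            tm_val S ((!) (x @ b)) (Var (n + ix a)) = a"
          using ix[of a] that by (simp add: nth_append)
      qed
      also have "\<dots> \<longleftrightarrow> holds S \<phi> x"
        using that fv by (intro holds_cong) (auto simp: nth_append)
      finally show ?thesis .
    qed
  qed
qed

section \<open>Countability of the set of formulas\<close>

instance tm :: (countable, countable) countable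
  by countable_datatype

instance fm :: (countable, countable, countable) countable
  by countable_datatype

lemma set1_tm_wf: "wf_tm L t \<Longrightarrow> set1_tm t \<subseteq> Funs L"
  by (induction t) (auto simp: list_all_iff)

lemma set12_fm_wf: "wf_fm L \<phi> \<Longrightarrow> set1_fm \<phi> \<subseteq> Funs L \<and> set2_fm \<phi> \<subseteq> Rels L"
  by (induction \<phi>) (auto simp: list_all_iff dest!: set1_tm_wf)

text \<open>Only the symbol sets and \<open>A\<close> are countable, not their types. Coding them by
  natural numbers is injective on the formulas concerned and leads into a countable
  datatype.\<close>

lemma countable_form:
  assumes "countable_lang L" "countable A"
  shows "countable (form L A n)"
proof -
  let ?h = "map_fm (to_nat_on (Funs L)) (to_nat_on (Rels L)) (to_nat_on A)"
  have inj: "inj_on (to_nat_on (Funs L)) (Funs L)" "inj_on (to_nat_on (Rels L)) (Rels L)"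
    "inj_on (to_nat_on A) A"
    using assms by (auto simp: countable_lang_def)
  have "inj_on ?h (form L A n)"
  proof (rule inj_onI)
    fix \<phi> \<psi> assume h: "\<phi> \<in> form L A n" "\<psi> \<in> form L A n" "?h \<phi> = ?h \<psi>"
    have "set1_fm \<phi> \<subseteq> Funs L" "set2_fm \<phi> \<subseteq> Rels L" "set1_fm \<psi> \<subseteq> Funs L" "set2_fm \<psi> \<subseteq> Rels L"
      "fm_params \<phi> \<subseteq> A" "fm_params \<psi> \<subseteq> A"
      using h set12_fm_wf by (auto simp: form_def)
    then show "\<phi> = \<psi>"
      using h(3) inj by (intro fm.inj_map_strong[OF _ _ _ h(3)]) (auto dest: inj_onD)
  qed
  then show ?thesis by (rule countableI')
qed

section \<open>Alternations of a Boolean sequence\<close>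

text \<open>Start with \<open>N\<close> and append the next index after each change of value. The
  clause on \<open>last ks\<close> carries the induction: it tells that a change at
  \<open>N + K\<close> makes the appended value differ from the last one.\<close>

lemma alternating_list:
  fixes f :: "nat \<Rightarrow> bool"
  shows "\<exists>ks. sorted_wrt (<) ks \<and> ks \<noteq> [] \<and> set ks \<subseteq> {N..N + K} \<and>
    length ks = Suc (card {l \<in> {N..<N + K}. f l \<noteq> f (Suc l)}) \<and>
    (\<forall>j<length ks. f (ks ! j) \<longleftrightarrow> (even j \<longleftrightarrow> f (hd ks))) \<and> f (last ks) = f (N + K)"
proof (induction K)
  case 0
  show ?case by (rule exI[of _ "[N]"]) auto
next
  case (Suc K)
  let ?C = "\<lambda>K. {l \<in> {N..<N + K}. f l \<noteq> f (Suc l)}"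
  obtain ks where IH: "sorted_wrt (<) ks" "ks \<noteq> []" "set ks \<subseteq> {N..N + K}"
    "length ks = Suc (card (?C K))" "\<forall>j<length ks. f (ks ! j) \<longleftrightarrow> (even j \<longleftrightarrow> f (hd ks))"
    "f (last ks) = f (N + K)"
    using Suc.IH by blast
  show ?case
  proof (cases "f (N + K) = f (Suc (N + K))")
    case True
    then have eq: "?C (Suc K) = ?C K" by (auto simp: less_Suc_eq)
    have "set ks \<subseteq> {N..N + Suc K}" using IH(3) by force
    moreover have "f (last ks) = f (N + Suc K)" using IH(6) True by simp
    ultimately show ?thesis using IH(1,2,4,5) unfolding eq by blast
  next
    case False
    then have eq: "?C (Suc K) = insert (N + K) (?C K)" by (auto simp: less_Suc_eq)
    have card: "card (?C (Suc K)) = Suc (card (?C K))" unfolding eq by simp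
    have "f (last ks) \<longleftrightarrow> (even (length ks - 1) \<longleftrightarrow> f (hd ks))"
      using IH(2,5) by (simp add: last_conv_nth)
    moreover have "even (length ks) \<longleftrightarrow> odd (length ks - 1)"
      using IH(2) by (cases ks) auto
    ultimately have "f (N + Suc K) \<longleftrightarrow> (even (length ks) \<longleftrightarrow> f (hd ks))"
      using False IH(6) unfolding add_Suc_right by blast
    then have alt: "f ((ks @ [N + Suc K]) ! j) \<longleftrightarrow> (even j \<longleftrightarrow> f (hd (ks @ [N + Suc K])))"
      if "j < length (ks @ [N + Suc K])" for j
      using that IH(2,5) by (cases "j < length ks") (simp_all add: nth_append less_Suc_eq)
    have "sorted_wrt (<) (ks @ [N + Suc K])"
      using IH(1,3) by (fastforce simp: sorted_wrt_append)
    moreover have "set (ks @ [N + Suc K]) \<subseteq> {N..N + Suc K}" using IH(3) by force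
    moreover have "length (ks @ [N + Suc K]) = Suc (card (?C (Suc K)))" using IH(4) card by simp
    moreover have "f (last (ks @ [N + Suc K])) = f (N + Suc K)" "ks @ [N + Suc K] \<noteq> []" by simp_all
    ultimately show ?thesis using alt by blast
  qed
qed

text \<open>At most \<open>N\<close> changes start before \<open>N\<close>. More than
  \<open>r\<close> representatives of the changes after \<open>N\<close> would contain
  \<open>r\<close> consecutive ones with the forbidden alternating pattern.\<close>

lemma few_changes:
  fixes f :: "nat \<Rightarrow> bool"
  assumes "\<And>ks. sorted_wrt (<) ks \<Longrightarrow> length ks = r \<Longrightarrow> set ks \<subseteq> {N..} \<Longrightarrow>
    \<exists>j<r. f (ks ! j) \<noteq> (even j \<longleftrightarrow> b)"
  shows "card {l \<in> {..<K}. f l \<noteq> f (Suc l)} \<le> N + r"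
proof -
  obtain ks where ks: "sorted_wrt (<) ks" "set ks \<subseteq> {N..N + K}"
    "length ks = Suc (card {l \<in> {N..<N + K}. f l \<noteq> f (Suc l)})"
    "\<forall>j<length ks. f (ks ! j) \<longleftrightarrow> (even j \<longleftrightarrow> f (hd ks))"
    using alternating_list[of N K f] by blast
  have "length ks \<le> r"
  proof (rule ccontr)
    assume len: "\<not> length ks \<le> r"
    \<comment> \<open>An alternating list may start with the wrong value; dropping its first entry
      then gives the pattern that starts with \<open>b\<close>. This is why more than
      \<open>r\<close> entries are assumed.\<close>
    define m where "m = (if f (hd ks) \<longleftrightarrow> b then 0 else 1 :: nat)"
    have m: "m \<le> 1" by (simp add: m_def)
    have "\<exists>j<r. f (take r (drop m ks) ! j) \<noteq> (even j \<longleftrightarrow> b)"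
    proof (rule assms)
      show "sorted_wrt (<) (take r (drop m ks))"
        using ks(1) by (intro sorted_wrt_take sorted_wrt_drop)
      show "length (take r (drop m ks)) = r" using len m by simp
      show "set (take r (drop m ks)) \<subseteq> {N..}"
        using ks(2) by (meson atLeastAtMost_iff atLeast_iff in_set_dropD in_set_takeD subset_iff)
    qed
    then obtain j where j: "j < r" "f (take r (drop m ks) ! j) \<noteq> (even j \<longleftrightarrow> b)"
      by blast
    then have "f (ks ! (m + j)) \<noteq> (even j \<longleftrightarrow> b)"
      using len m by simp
    moreover have "f (ks ! (m + j)) \<longleftrightarrow> (even (m + j) \<longleftrightarrow> f (hd ks))"
      using ks(4) j len m by simp
    ultimately show False by (auto simp: m_def split: if_splits)
  qed
  then have "card {l \<in> {N..<N + K}. f l \<noteq> f (Suc l)} \<le> r" using ks(3) by simp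
  moreover have "card {l \<in> {..<K}. f l \<noteq> f (Suc l)} \<le>
      card ({..<N} \<union> {l \<in> {N..<N + K}. f l \<noteq> f (Suc l)})"
    by (rule card_mono) auto
  moreover have "\<dots> \<le> N + card {l \<in> {N..<N + K}. f l \<noteq> f (Suc l)}"
    using card_Un_le[of "{..<N}"] by simp
  ultimately show ?thesis by linarith
qed

lemma change_between:
  fixes f :: "nat \<Rightarrow> bool"
  assumes "m < k" "f m \<noteq> f k"
  obtains l where "m \<le> l" "l < k" "f l \<noteq> f (Suc l)"
proof -
  have "f k' = f m" if "m \<le> k'" "k' \<le> k" "\<And>l. m \<le> l \<Longrightarrow> l < k \<Longrightarrow> f l = f (Suc l)" for k'
    using that(1,2)
  proof (induction k' rule: dec_induct)
    case (step l)
    then show ?case using that(3)[of l] by simp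
  qed simp
  then show thesis using assms that by (metis less_imp_le order_refl)
qed

text \<open>Between two successive entries with different values some change occurs, and these
  changes lie in disjoint intervals.\<close>

lemma many_changes:
  fixes f :: "nat \<Rightarrow> bool"
  assumes "sorted_wrt (<) ks" "ks \<noteq> []"
    "\<And>j. Suc j < length ks \<Longrightarrow> f (ks ! Suc j) \<noteq> f (ks ! j)"
  shows "length ks \<le> Suc (card {l \<in> {..<last ks}. f l \<noteq> f (Suc l)})"
  using assms
proof (induction ks rule: rev_induct)
  case (snoc k ks)
  show ?case
  proof (cases "ks = []")
    case False
    define m where "m = last ks"
    let ?C = "\<lambda>K. {l \<in> {..<K}. f l \<noteq> f (Suc l)}"
    have mk: "m < k"
      using snoc.prems(1) False by (auto simp: m_def sorted_wrt_append)
    have "length ks \<le> Suc (card (?C m))"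
      unfolding m_def
    proof (rule snoc.IH)
      show "f (ks ! Suc j) \<noteq> f (ks ! j)" if "Suc j < length ks" for j
        using snoc.prems(3)[of j] that by (simp add: nth_append)
    qed (use snoc.prems(1) False in \<open>auto simp: sorted_wrt_append\<close>)
    moreover obtain l where l: "m \<le> l" "l < k" "f l \<noteq> f (Suc l)"
    proof (rule change_between[OF mk])
      show "f m \<noteq> f k"
        using snoc.prems(3)[of "length ks - 1"] False by (auto simp: nth_append m_def last_conv_nth)
    qed
    moreover have "card (insert l (?C m)) \<le> card (?C k)"
      using l mk by (intro card_mono) auto
    moreover have "card (insert l (?C m)) = Suc (card (?C m))"
      using l by simp
    ultimately show ?thesis by simp
  qed simp
qed simp

text \<open>Both values recur infinitely often, so the indices for any prescribed pattern
  \<open>w\<close> can be picked greedily.\<close>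

lemma oscillating_list:
  fixes f :: "nat \<Rightarrow> bool"
  assumes "\<exists>\<^sub>\<infinity>i. f i" "\<exists>\<^sub>\<infinity>i. \<not> f i"
  shows "\<exists>ks. sorted_wrt (<) ks \<and> length ks = r \<and> (\<forall>j<r. f (ks ! j) = w j)"
proof (induction r)
  case (Suc r)
  then obtain ks where ks: "sorted_wrt (<) ks" "length ks = r" "\<forall>j<r. f (ks ! j) = w j"
    by blast
  have "\<exists>\<^sub>\<infinity>i. f i = w r" using assms by (cases "w r") auto
  \<comment> \<open>The sum of a list of natural numbers serves as an upper bound for its
    members.\<close>
  then obtain i where i: "i > sum_list ks" "f i = w r" by (auto simp: INFM_nat)
  have "j < i" if "j \<in> set ks" for j
    using member_le_sum_list[OF that] i(1) by simp
  then show ?case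
    using ks i(2) by (intro exI[of _ "ks @ [i]"]) (auto simp: sorted_wrt_append nth_append less_Suc_eq)
qed simp

lemma sum_changes:
  "(\<Sum>i<K. \<bar>of_bool (f i) - of_bool (f (Suc i))\<bar> :: real) = card {l \<in> {..<K}. f l \<noteq> f (Suc l)}"
proof -
  have "(\<Sum>i<K. \<bar>of_bool (f i) - of_bool (f (Suc i))\<bar> :: real) = (\<Sum>i<K. of_bool (f i \<noteq> f (Suc i)))"
    by (intro sum.cong) auto
  also have "\<dots> = card {l \<in> {..<K}. f l \<noteq> f (Suc l)}"
    by (simp add: sum_of_bool_eq Int_def)
  finally show ?thesis .
qed

text \<open>The partial sums of the series count changes, and a series of nonnegative terms is
  bounded exactly if its partial sums are. From here on DBSC-convergence is a matter of
  counting.\<close>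

lemma bounded_variation_iff:
  "summable (\<lambda>i. \<bar>of_bool (f i) - of_bool (f (Suc i))\<bar> :: real) \<and>
     (\<Sum>i. \<bar>of_bool (f i) - of_bool (f (Suc i))\<bar>) \<le> real N \<longleftrightarrow>
   (\<forall>K. card {l \<in> {..<K}. f l \<noteq> f (Suc l)} \<le> N)" (is "?S \<longleftrightarrow> ?C")
proof
  assume S: ?S
  show ?C
  proof
    fix K
    have "real (card {l \<in> {..<K}. f l \<noteq> f (Suc l)}) \<le> (\<Sum>i. \<bar>of_bool (f i) - of_bool (f (Suc i))\<bar>)"
      unfolding sum_changes[symmetric] using S by (intro sum_le_suminf) auto
    then show "card {l \<in> {..<K}. f l \<noteq> f (Suc l)} \<le> N" using S by linarith
  qed
next
  assume ?C
  then have b: "(\<Sum>i<K. \<bar>of_bool (f i) - of_bool (f (Suc i))\<bar>) \<le> real N" for K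
    by (simp add: sum_changes)
  then have "summable (\<lambda>i. \<bar>of_bool (f i) - of_bool (f (Suc i))\<bar> :: real)"
    by (intro summableI_nonneg_bounded) auto
  then show ?S using b suminf_le_const by blast
qed

lemma dbsc_convergent_iff:
  "dbsc_convergent L U n a \<longleftrightarrow> (\<forall>k. \<forall>\<phi>\<in>form L {} (n + k). \<exists>N. \<forall>b\<in>nlists k (carr U). \<forall>K.
     card {l \<in> {..<K}. holds U \<phi> (a l @ b) \<noteq> holds U \<phi> (a (Suc l) @ b)} \<le> N)"
  unfolding dbsc_convergent_def
    bounded_variation_iff[where f = "\<lambda>i. holds U \<phi> (a i @ b)" for \<phi> b] ..

text \<open>Otherwise both values recur for ever and \<open>N + 2\<close> alternating entries can be
  picked, which force \<open>N + 1\<close> changes.\<close>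

lemma bounded_changes_imp_eventually_constant:
  fixes f :: "nat \<Rightarrow> bool"
  assumes "\<And>K. card {l \<in> {..<K}. f l \<noteq> f (Suc l)} \<le> N"
  shows "(\<forall>\<^sub>F i in sequentially. f i) \<or> (\<forall>\<^sub>F i in sequentially. \<not> f i)"
proof (rule ccontr)
  assume "\<not> ?thesis"
  then have "\<exists>\<^sub>\<infinity>i. f i" "\<exists>\<^sub>\<infinity>i. \<not> f i"
    by (auto simp: cofinite_eq_sequentially not_eventually)
  then obtain ks where ks: "sorted_wrt (<) ks" "length ks = N + 2" "\<forall>j<N + 2. f (ks ! j) = even j"
    using oscillating_list[of f "N + 2" even] by blast
  then have "length ks \<le> Suc (card {l \<in> {..<last ks}. f l \<noteq> f (Suc l)})"
    by (intro many_changes) auto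
  then show False using assms[of "last ks"] ks(2) by simp
qed


section \<open>Formulas in blocks of variables\<close>

lemma nth_concat_blocks:
  assumes "\<And>x. x \<in> set xs \<Longrightarrow> length x = n" "j < length xs" "i < n"
  shows "concat xs ! (j * n + i) = xs ! j ! i"
  using assms
proof (induction xs arbitrary: j)
  case (Cons x xs)
  then show ?case by (cases j) (auto simp: nth_append)
qed simp

lemma length_concat_blocks:
  "(\<And>x. x \<in> set xs \<Longrightarrow> length x = n) \<Longrightarrow> length (concat xs) = n * length xs"
  by (induction xs) auto

lemma form_Conj_less:
  fixes r :: nat
  assumes "carr U \<noteq> {}" and "\<And>j. j < r \<Longrightarrow> \<chi> j \<in> form L B n"
  shows "\<exists>\<theta>\<in>form L B n. \<forall>z. holds U \<theta> z \<longleftrightarrow> (\<forall>j<r. holds U (\<chi> j) z)"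
  using assms(2)
proof (induction r)
  case 0
  \<comment> \<open>The empty conjunction has to be a formula without free variables, as
    \<open>n\<close> may be 0; there is no symbol for truth, so \<open>\<exists>v. v = v\<close>
    takes its place, valid on a nonempty carrier.\<close>
  show ?case
    using assms(1) by (intro bexI[of _ "Ex 0 (Eq (Var 0) (Var 0))"]) (auto simp: form_def holds_def)
next
  case (Suc r)
  then obtain \<theta> where "\<theta> \<in> form L B n" "\<forall>z. holds U \<theta> z \<longleftrightarrow> (\<forall>j<r. holds U (\<chi> j) z)"
    by (meson less_Suc_eq)
  then show ?case
    using Suc.prems[of r] by (intro bexI[of _ "Conj \<theta> (\<chi> r)"]) (auto simp: less_Suc_eq)
qed

lemma form_Ex_block:
  assumes "\<theta> \<in> form L B (n + k)"
  shows "\<exists>\<psi>\<in>form L B n. \<forall>z. length z = n \<longrightarrow>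
    (holds U \<psi> z \<longleftrightarrow> (\<exists>y\<in>nlists k (carr U). holds U \<theta> (z @ y)))"
  using assms
proof (induction k arbitrary: \<theta>)
  case 0
  then show ?case by auto
next
  case (Suc k)
  \<comment> \<open>The variable with the highest index is bound innermost; the induction hypothesis
    then binds the others.\<close>
  have "Ex (n + k) \<theta> \<in> form L B (n + k)"
    using Suc.prems by (auto simp: form_def less_Suc_eq)
  then obtain \<psi> where \<psi>: "\<psi> \<in> form L B n" "\<And>z. length z = n \<Longrightarrow>
      holds U \<psi> z \<longleftrightarrow> (\<exists>y\<in>nlists k (carr U). holds U (Ex (n + k) \<theta>) (z @ y))"
    using Suc.IH by blast
  have "holds U \<psi> z \<longleftrightarrow> (\<exists>y\<in>nlists (Suc k) (carr U). holds U \<theta> (z @ y))" if "length z = n" for z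
  proof -
    have "holds U (Ex (n + k) \<theta>) (z @ y) \<longleftrightarrow> (\<exists>a\<in>carr U. holds U \<theta> (z @ y @ [a]))"
      if "y \<in> nlists k (carr U)" for y
    proof -
      have "sat U (((!) (z @ y))(n + k := a)) \<theta> \<longleftrightarrow> holds U \<theta> (z @ y @ [a])" for a
      proof (rule holds_cong)
        fix v assume "v \<in> fv \<theta>"
        then have "v < Suc (n + k)" using Suc.prems by (auto simp: form_def)
        then show "(((!) (z @ y))(n + k := a)) v = (z @ y @ [a]) ! v"
          using that \<open>length z = n\<close> by (auto simp: nth_append less_Suc_eq)
      qed
      then show ?thesis by (simp add: holds_def)
    qed
    moreover have "(\<exists>y\<in>nlists (Suc k) (carr U). holds U \<theta> (z @ y)) \<longleftrightarrow>
        (\<exists>y\<in>nlists k (carr U). \<exists>a\<in>carr U. holds U \<theta> (z @ y @ [a]))" (is "?l = ?r")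
    proof
      assume ?l
      then obtain y where y: "y \<in> nlists (Suc k) (carr U)" "holds U \<theta> (z @ y)" by blast
      then have "y \<noteq> []" using nlistsE_length by fastforce
      then have "y = butlast y @ [last y]" by simp
      moreover have "butlast y \<in> nlists k (carr U)" "last y \<in> carr U"
        using y(1) \<open>y \<noteq> []\<close> by (auto dest: in_set_butlastD)
      ultimately show ?r using y(2) by metis
    next
      assume ?r
      then obtain y a where "y \<in> nlists k (carr U)" "a \<in> carr U" "holds U \<theta> (z @ y @ [a])"
        by blast
      then show ?l by (intro bexI[of _ "y @ [a]"]) (auto)
    qed
    ultimately show ?thesis using \<psi>(2)[OF that] by simp
  qed
  then show ?case using \<psi>(1) by blast
qed

text \<open>That some common \<open>y\<close> realizes the pattern \<open>w\<close> along a tuple of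
  blocks is first-order in that tuple. With \<open>y\<close> quantified away, the parameters are
  only those of \<open>\<phi>\<close>, so the property can be passed between tuples.\<close>

lemma form_pattern:
  fixes U :: "('f, 'r, 'u) struct" and \<phi> :: "('f, 'r, 'u) fm"
  assumes "carr U \<noteq> {}" and "\<phi> \<in> form L B (n + k)"
  obtains \<psi> where "\<psi> \<in> form L B (n * r)"
    "\<And>xs. length xs = r \<Longrightarrow> (\<And>x. x \<in> set xs \<Longrightarrow> length x = n) \<Longrightarrow>
      holds U \<psi> (concat xs) \<longleftrightarrow> (\<exists>y\<in>nlists k (carr U). \<forall>j<r. holds U \<phi> (xs ! j @ y) = w j)"
proof -
  have "\<exists>\<chi>\<in>form L B (n * r + k). \<forall>xs y. length xs = r \<longrightarrow> (\<forall>x\<in>set xs. length x = n) \<longrightarrow>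
      length y = k \<longrightarrow> (holds U \<chi> (concat xs @ y) \<longleftrightarrow> holds U \<phi> (xs ! j @ y) = w j)"
    if "j < r" for j
  proof -
    \<comment> \<open>The variables of \<open>x\<close> go to the \<open>j\<close>-th block; those
      of \<open>y\<close> go behind all blocks, to the same place for every
      \<open>j\<close>.\<close>
    define f where "f v = (if v < n then j * n + v else n * r + (v - n))" for v
    have jn: "j * n + v < n * r" if "v < n" for v
    proof -
      have "j * n + v < Suc j * n" using that by simp
      also have "\<dots> \<le> r * n" using \<open>j < r\<close> by (intro mult_right_mono) auto
      finally show ?thesis by (simp add: mult.commute)
    qed
    have "f v < n * r + k" if "v < n + k" for v
      using jn[of v] that by (auto simp: f_def)
    then obtain \<chi> where \<chi>: "\<chi> \<in> form L B (n * r + k)"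
      "\<And>S x y. length x = n + k \<Longrightarrow> (\<And>v. v < n + k \<Longrightarrow> y ! f v = x ! v) \<Longrightarrow>
        holds S \<chi> y \<longleftrightarrow> holds S \<phi> x"
      using form_rename[OF assms(2)] by metis
    have "holds U \<chi> (concat xs @ y) \<longleftrightarrow> holds U \<phi> (xs ! j @ y)"
      if xs: "length xs = r" "\<forall>x\<in>set xs. length x = n" "length y = k" for xs y
    proof (rule \<chi>(2))
      have [simp]: "length (xs ! j) = n" using xs \<open>j < r\<close> by simp
      have [simp]: "length (concat xs) = n * r" using length_concat_blocks[of xs n] xs by simp
      show "length (xs ! j @ y) = n + k" using xs by simp
      show "(concat xs @ y) ! f v = (xs ! j @ y) ! v" if "v < n + k" for v
        using xs \<open>j < r\<close> that jn[of v] nth_concat_blocks[of xs n j v] by (auto simp: f_def nth_append)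
    qed
    then show ?thesis
      using \<chi>(1) by (intro bexI[of _ "if w j then \<chi> else Neg \<chi>"]) auto
  qed
  then obtain \<chi> where \<chi>: "\<And>j. j < r \<Longrightarrow> \<chi> j \<in> form L B (n * r + k)"
    "\<And>j xs y. j < r \<Longrightarrow> length xs = r \<Longrightarrow> (\<forall>x\<in>set xs. length x = n) \<Longrightarrow> length y = k \<Longrightarrow>
      holds U (\<chi> j) (concat xs @ y) \<longleftrightarrow> holds U \<phi> (xs ! j @ y) = w j"
    by metis
  obtain \<theta> where \<theta>: "\<theta> \<in> form L B (n * r + k)" "\<And>z. holds U \<theta> z \<longleftrightarrow> (\<forall>j<r. holds U (\<chi> j) z)"
    using form_Conj_less[OF assms(1), of r \<chi>] \<chi>(1) by blast
  obtain \<psi> where \<psi>: "\<psi> \<in> form L B (n * r)" "\<And>z. length z = n * r \<Longrightarrow>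
      holds U \<psi> z \<longleftrightarrow> (\<exists>y\<in>nlists k (carr U). holds U \<theta> (z @ y))"
    using form_Ex_block[OF \<theta>(1)] by blast
  show thesis
  proof (rule that[OF \<psi>(1)])
    fix xs :: "'u list list"
    assume xs: "length xs = r" "\<And>x. x \<in> set xs \<Longrightarrow> length x = n"
    have "length (concat xs) = n * r" using length_concat_blocks[of xs n] xs by simp
    then show "holds U \<psi> (concat xs) \<longleftrightarrow>
        (\<exists>y\<in>nlists k (carr U). \<forall>j<r. holds U \<phi> (xs ! j @ y) = w j)"
      using xs \<chi>(2) by (auto simp: \<psi>(2) \<theta>(2))
  qed
qed

section \<open>Global types finitely satisfiable in a countable set\<close>

lemma tm_val_automorphism:
  assumes "is_struct L U" "automorphism L U \<sigma>"
  shows "wf_tm L t \<Longrightarrow> tm_params t \<subseteq> carr U \<Longrightarrow> (\<And>v. v \<in> fv_tm t \<Longrightarrow> e v \<in> carr U) \<Longrightarrow>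
    tm_val U e t \<in> carr U \<and> tm_val U (\<sigma> \<circ> e) (map_tm id \<sigma> t) = \<sigma> (tm_val U e t)"
proof (induction t)
  case (App f ts)
  have IH: "tm_val U e t \<in> carr U \<and> tm_val U (\<sigma> \<circ> e) (map_tm id \<sigma> t) = \<sigma> (tm_val U e t)"
    if "t \<in> set ts" for t
    by (rule App.IH[OF that]) (use that App.prems in \<open>auto simp: list_all_iff\<close>)
  have f: "f \<in> Funs L" "map (tm_val U e) ts \<in> nlists (far L f) (carr U)"
    using App.prems(1) IH by auto
  have "map (\<lambda>t. tm_val U (\<sigma> \<circ> e) (map_tm id \<sigma> t)) ts = map (\<lambda>t. \<sigma> (tm_val U e t)) ts"
    using IH by (intro map_cong) auto
  then have "tm_val U (\<sigma> \<circ> e) (map_tm id \<sigma> (App f ts)) = fint U f (map \<sigma> (map (tm_val U e) ts))"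
    by (simp add: comp_def del: map_eq_conv)
  also have "\<dots> = \<sigma> (fint U f (map (tm_val U e) ts))"
    using assms(2) f unfolding automorphism_def by simp
  finally have "tm_val U (\<sigma> \<circ> e) (map_tm id \<sigma> (App f ts)) = \<sigma> (tm_val U e (App f ts))"
    unfolding tm_val.simps .
  moreover have "tm_val U e (App f ts) \<in> carr U"
    using assms(1) f unfolding is_struct_def by simp
  ultimately show ?case by blast
qed auto

lemma sat_automorphism:
  assumes "is_struct L U" "automorphism L U \<sigma>"
  shows "wf_fm L \<phi> \<Longrightarrow> fm_params \<phi> \<subseteq> carr U \<Longrightarrow> (\<And>v. v \<in> fv \<phi> \<Longrightarrow> e v \<in> carr U) \<Longrightarrow>
    sat U (\<sigma> \<circ> e) (map_fm id id \<sigma> \<phi>) \<longleftrightarrow> sat U e \<phi>"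
proof (induction \<phi> arbitrary: e)
  case (Eq s t)
  have st: "tm_val U e s \<in> carr U \<and> tm_val U (\<sigma> \<circ> e) (map_tm id \<sigma> s) = \<sigma> (tm_val U e s)"
    "tm_val U e t \<in> carr U \<and> tm_val U (\<sigma> \<circ> e) (map_tm id \<sigma> t) = \<sigma> (tm_val U e t)"
    using Eq by (intro tm_val_automorphism[OF assms]; auto)+
  have "inj_on \<sigma> (carr U)"
    using assms(2) by (simp add: automorphism_def bij_betw_def)
  then have "\<sigma> (tm_val U e s) = \<sigma> (tm_val U e t) \<longleftrightarrow> tm_val U e s = tm_val U e t"
    using st by (intro inj_on_eq_iff) auto
  then show ?case using st by (simp only: fm.map sat.simps)
next
  case (Rel R ts)
  have IH: "tm_val U e t \<in> carr U \<and> tm_val U (\<sigma> \<circ> e) (map_tm id \<sigma> t) = \<sigma> (tm_val U e t)"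
    if "t \<in> set ts" for t
    using Rel that by (intro tm_val_automorphism[OF assms]) (auto simp: list_all_iff)
  have R: "R \<in> Rels L" "map (tm_val U e) ts \<in> nlists (rar L R) (carr U)"
    using Rel.prems(1) IH by auto
  have "map (\<lambda>t. tm_val U (\<sigma> \<circ> e) (map_tm id \<sigma> t)) ts = map (\<lambda>t. \<sigma> (tm_val U e t)) ts"
    using IH by (intro map_cong) auto
  then have "sat U (\<sigma> \<circ> e) (map_fm id id \<sigma> (Rel R ts)) \<longleftrightarrow> rint U R (map \<sigma> (map (tm_val U e) ts))"
    by (simp add: comp_def del: map_eq_conv)
  moreover have "rint U R (map \<sigma> (map (tm_val U e) ts)) = rint U R (map (tm_val U e) ts)"
    using assms(2) R unfolding automorphism_def by blast
  ultimately show ?case by (simp only: sat.simps)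
next
  case (Ex v \<phi>)
  have "sat U ((\<sigma> \<circ> e)(v := \<sigma> a)) (map_fm id id \<sigma> \<phi>) \<longleftrightarrow> sat U (e(v := a)) \<phi>"
    if "a \<in> carr U" for a
  proof -
    have "sat U (\<sigma> \<circ> e(v := a)) (map_fm id id \<sigma> \<phi>) \<longleftrightarrow> sat U (e(v := a)) \<phi>"
      by (rule Ex.IH) (use Ex.prems that in auto)
    moreover have "\<sigma> \<circ> e(v := a) = (\<sigma> \<circ> e)(v := \<sigma> a)" by auto
    ultimately show ?thesis by simp
  qed
  moreover have "carr U = \<sigma> ` carr U"
    using assms(2) by (simp add: automorphism_def bij_betw_def)
  ultimately show ?case by (smt (verit) fm.map(5) image_iff sat.simps(5))
qed auto

lemma map_tm_syntax:
  "wf_tm L (map_tm id \<sigma> t) = wf_tm L t" "fv_tm (map_tm id \<sigma> t) = fv_tm t"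
  by (induction t) (auto simp: list_all_iff)

lemma map_fm_syntax:
  "wf_fm L (map_fm id id \<sigma> \<phi>) = wf_fm L \<phi>" "fv (map_fm id id \<sigma> \<phi>) = fv \<phi>"
  by (induction \<phi>) (auto simp: list_all_iff map_tm_syntax)

lemma map_fm_in_form:
  "\<phi> \<in> form L A n \<Longrightarrow> \<sigma> ` A \<subseteq> B \<Longrightarrow> map_fm id id \<sigma> \<phi> \<in> form L B n"
  by (auto simp: form_def map_fm_syntax fm.set_map)

text \<open>\<open>A\<close> stands for the universe of \<open>M\<close>, and saturation is stated
  for countable parameter sets, the form that an uncountable \<open>\<kappa>\<close>
  supplies.\<close>

locale countable_subset =
  fixes L :: "('f, 'r) lang" and U :: "('f, 'r, 'u) struct" and A :: "'u set"
  assumes countable_L: "countable_lang L"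
    and struct_U: "is_struct L U"
    and A_sub: "A \<subseteq> carr U"
    and A_nonempty: "A \<noteq> {}"
    and countable_A: "countable A"
    and countably_saturated: "\<And>B n \<Gamma>. B \<subseteq> carr U \<Longrightarrow> countable B \<Longrightarrow> \<Gamma> \<subseteq> form L B n \<Longrightarrow>
      fin_sat U (carr U) n \<Gamma> \<Longrightarrow> \<exists>as\<in>nlists n (carr U). \<forall>\<phi>\<in>\<Gamma>. holds U \<phi> as"
begin

lemma carr_nonempty: "carr U \<noteq> {}"
  using A_sub A_nonempty by auto

lemma tp_convergent_oscillation:
  assumes "\<And>i. length (d i) = n" "\<not> tp_convergent L U n d"
  obtains k b \<phi> where "b \<in> nlists k (carr U)" "\<phi> \<in> form L {} (n + k)"
    "\<exists>\<^sub>\<infinity>i. holds U \<phi> (d i @ b)" "\<exists>\<^sub>\<infinity>i. \<not> holds U \<phi> (d i @ b)"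
proof -
  obtain \<phi> where \<phi>: "\<phi> \<in> form L (carr U) n" "\<exists>\<^sub>\<infinity>i. holds U \<phi> (d i)" "\<exists>\<^sub>\<infinity>i. \<not> holds U \<phi> (d i)"
    using assms(2) by (auto simp: tp_convergent_def cofinite_eq_sequentially not_eventually)
  obtain k b \<phi>\<^sub>0 where "b \<in> nlists k (carr U)" "\<phi>\<^sub>0 \<in> form L {} (n + k)"
    "\<And>S x. length x = n \<Longrightarrow> holds S \<phi>\<^sub>0 (x @ b) \<longleftrightarrow> holds S \<phi> x"
    using form_separate_params[OF \<phi>(1)] by metis
  note * = this
  show thesis
  proof (rule that[OF *(1,2)])
    show "\<exists>\<^sub>\<infinity>i. holds U \<phi>\<^sub>0 (d i @ b)"
      using \<phi>(2) by (simp add: *(3) assms(1))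
    show "\<exists>\<^sub>\<infinity>i. \<not> holds U \<phi>\<^sub>0 (d i @ b)"
      using \<phi>(3) by (simp add: *(3) assms(1))
  qed
qed

text \<open>Compactness: if arbitrarily long initial segments of \<open>d\<close> were alternated by
  some \<open>y\<close>, the conditions \<open>\<phi>(d j, y) = even j\<close> would form a finitely
  satisfiable set over countably many parameters. A realization alternates along all of
  \<open>d\<close>, against convergence.\<close>

lemma bounded_alternation:
  assumes d: "\<And>i. d i \<in> nlists n (carr U)" and conv: "tp_convergent L U n d"
    and \<phi>: "\<phi> \<in> form L {} (n + k)"
  obtains r where "\<forall>y\<in>nlists k (carr U). \<exists>j<r. holds U \<phi> (d j @ y) \<noteq> even j"
proof -
  have False if *: "\<And>r. \<exists>y\<in>nlists k (carr U). \<forall>j<r. holds U \<phi> (d j @ y) = even j"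
  proof -
    let ?D = "\<Union>j. set (d j)"
    have D: "?D \<subseteq> carr U" "countable ?D" using d by (auto intro: countable_finite)
    have "\<exists>\<theta>\<in>form L ?D k. \<forall>y. length y = k \<longrightarrow> (holds U \<theta> y \<longleftrightarrow> holds U \<phi> (d j @ y) = even j)" for j
    proof -
      obtain \<theta> where "\<theta> \<in> form L ?D k" "\<And>S y. length y = k \<Longrightarrow> holds S \<theta> y \<longleftrightarrow> holds S \<phi> (d j @ y @ [])"
      proof (rule form_plug[of \<phi> L "{}" "d j" k "[]" ?D])
        show "\<phi> \<in> form L {} (length (d j) + k + length [])" using d[of j] \<phi> by simp
      qed auto
      then show ?thesis by (intro bexI[of _ "if even j then \<theta> else Neg \<theta>"]) auto
    qed
    then obtain \<theta> where \<theta>: "\<And>j. \<theta> j \<in> form L ?D k"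
      "\<And>j y. length y = k \<Longrightarrow> holds U (\<theta> j) y \<longleftrightarrow> holds U \<phi> (d j @ y) = even j"
      by metis
    have "\<exists>y\<in>nlists k (carr U). \<forall>\<psi>\<in>range \<theta>. holds U \<psi> y"
    proof (rule countably_saturated[OF D])
      show "range \<theta> \<subseteq> form L ?D k" using \<theta>(1) by auto
      show "fin_sat U (carr U) k (range \<theta>)"
        unfolding fin_sat_def
      proof (intro allI impI, elim conjE)
        fix \<Delta> assume "finite \<Delta>" "\<Delta> \<subseteq> range \<theta>"
        then obtain J where J: "finite J" "\<Delta> = \<theta> ` J" by (meson finite_subset_image)
        obtain r where r: "\<And>j. j \<in> J \<Longrightarrow> j < r" using J(1) by (meson finite_nat_set_iff_bounded)
        obtain y where y: "y \<in> nlists k (carr U)" "\<forall>j<r. holds U \<phi> (d j @ y) = even j"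
          using * by blast
        then have "\<forall>\<psi>\<in>\<Delta>. holds U \<psi> y" using J(2) r \<theta>(2) by simp
        then show "\<exists>as\<in>nlists k (carr U). \<forall>\<psi>\<in>\<Delta>. holds U \<psi> as" using y(1) by blast
      qed
    qed
    then obtain y where y: "y \<in> nlists k (carr U)" "\<And>j. holds U \<phi> (d j @ y) = even j"
      using \<theta>(2) by auto
    \<comment> \<open>With the realization \<open>y\<close> as parameters, \<open>\<phi>\<close>
      becomes a formula to which the convergence of \<open>d\<close> applies.\<close>
    obtain \<psi> where \<psi>: "\<psi> \<in> form L (carr U) n"
      "\<And>S x. length x = n \<Longrightarrow> holds S \<psi> x \<longleftrightarrow> holds S \<phi> ([] @ x @ y)"
    proof (rule form_plug[of \<phi> L "{}" "[]" n y "carr U"])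
      show "\<phi> \<in> form L {} (length [] + n + length y)" using y(1) \<phi> by simp
    qed (use y(1) in auto)
    have "holds U \<psi> (d i) = even i" for i
      using \<psi>(2) y(2) d[of i] by simp
    moreover have "(\<forall>\<^sub>F i in sequentially. holds U \<psi> (d i)) \<or>
        (\<forall>\<^sub>F i in sequentially. \<not> holds U \<psi> (d i))"
      using conv \<psi>(1) unfolding tp_convergent_def by blast
    ultimately have "(\<forall>\<^sub>F i in sequentially. even i) \<or> (\<forall>\<^sub>F i in sequentially. odd (i::nat))"
      by simp
    then show False
      unfolding eventually_sequentially by (metis even_Suc le_SucI order_refl)
  qed
  then show thesis using that by blast
qed

end

section \<open>Invariance and Morley sequences of a finitely satisfiable type\<close>

locale fs_type = countable_subset L U A
  for L :: "('f, 'r) lang" and U :: "('f, 'r, 'u) struct" and A :: "'u set" +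
  fixes n :: nat and p :: "('f, 'r, 'u) fm set"
  assumes p_type: "p \<in> types L U (carr U) n" and p_fs: "fin_sat U A n p"
begin

lemma p_form: "\<phi> \<in> p \<Longrightarrow> \<phi> \<in> form L (carr U) n"
  using p_type by (auto simp: types_def)

lemma p_finite: "finite \<Delta> \<Longrightarrow> \<Delta> \<subseteq> p \<Longrightarrow> \<exists>a\<in>nlists n A. \<forall>\<phi>\<in>\<Delta>. holds U \<phi> a"
  using p_fs unfolding fin_sat_def by blast

lemma p_Neg: "\<phi> \<in> form L (carr U) n \<Longrightarrow> Neg \<phi> \<in> p \<longleftrightarrow> \<phi> \<notin> p"
  using p_finite[of "{\<phi>, Neg \<phi>}"] p_type by (auto simp: types_def)

text \<open>An automorphism fixing \<open>A\<close> does not change the truth of a formula at tuples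
  of \<open>A\<close>. If \<open>p\<close> separated \<open>\<phi>\<close> from its image, one of
  them and the negation of the other would hold together at a tuple of \<open>A\<close>.\<close>

lemma p_invariant: "invariant_type L U A n p"
  unfolding invariant_type_def
proof (intro allI impI ballI, elim conjE)
  fix \<sigma> \<phi> assume \<sigma>: "automorphism L U \<sigma>" "\<forall>a\<in>A. \<sigma> a = a" and \<phi>: "\<phi> \<in> form L (carr U) n"
  let ?\<psi> = "map_fm id id \<sigma> \<phi>"
  have \<psi>: "?\<psi> \<in> form L (carr U) n"
    using \<phi> \<sigma>(1) by (intro map_fm_in_form) (auto simp: automorphism_def bij_betw_def)
  have eq: "holds U ?\<psi> a \<longleftrightarrow> holds U \<phi> a" if "a \<in> nlists n A" for a
  proof -
    have fv: "v < n" if "v \<in> fv \<phi>" for v using \<phi> that by (auto simp: form_def)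
    have a: "a ! v \<in> A" if "v < n" for v
      using \<open>a \<in> nlists n A\<close> that by (auto intro: subsetD nth_mem)
    have "sat U (\<sigma> \<circ> (!) a) ?\<psi> \<longleftrightarrow> sat U ((!) a) \<phi>"
      using \<phi> fv a A_sub by (intro sat_automorphism[OF struct_U \<sigma>(1)]) (auto simp: form_def)
    moreover have "sat U (\<sigma> \<circ> (!) a) ?\<psi> \<longleftrightarrow> holds U ?\<psi> a"
      using fv a \<sigma>(2) by (intro holds_cong) (simp add: map_fm_syntax)
    ultimately show ?thesis by (simp add: holds_def)
  qed
  show "\<phi> \<in> p \<longleftrightarrow> ?\<psi> \<in> p"
  proof (rule ccontr)
    assume "\<not> ?thesis"
    then consider "\<phi> \<in> p" "Neg ?\<psi> \<in> p" | "Neg \<phi> \<in> p" "?\<psi> \<in> p"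
      using p_Neg[OF \<phi>] p_Neg[OF \<psi>] by blast
    then show False
    proof cases
      case 1
      then show False using p_finite[of "{\<phi>, Neg ?\<psi>}"] eq by auto
    next
      case 2
      then show False using p_finite[of "{Neg \<phi>, ?\<psi>}"] eq by auto
    qed
  qed
qed

text \<open>Recursion along the natural numbers: at each stage the restriction of \<open>p\<close>
  to the countable set of \<open>A\<close> and the earlier members is realized by
  saturation.\<close>

lemma morley_exists: "\<exists>d. morley_sequence L U A n p d"
proof -
  define P where "P d i x \<longleftrightarrow> x \<in> nlists n (carr U) \<and>
    (\<forall>\<phi>\<in>p \<inter> form L (A \<union> (\<Union>j<i. set (d j))) n. holds U \<phi> x)" for d and i :: nat and x
  have "\<exists>d. \<forall>i. P d i (d i)"
  proof (rule dependent_wellorder_choice)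
    fix r and d d' :: "nat \<Rightarrow> 'u list" and i :: nat
    assume "\<And>j. j < i \<Longrightarrow> d j = d' j"
    then have "(\<Union>j<i. set (d j)) = (\<Union>j<i. set (d' j))" by auto
    then show "P d i r = P d' i r" by (simp add: P_def)
  next
    fix i and d :: "nat \<Rightarrow> 'u list"
    assume d: "\<And>j. j < i \<Longrightarrow> P d j (d j)"
    let ?B = "A \<union> (\<Union>j<i. set (d j))"
    have "\<exists>x\<in>nlists n (carr U). \<forall>\<phi>\<in>p \<inter> form L ?B n. holds U \<phi> x"
    proof (rule countably_saturated)
      show "?B \<subseteq> carr U" using A_sub d by (fastforce simp: P_def)
      show "countable ?B" using countable_A by (auto intro: countable_finite)
      show "p \<inter> form L ?B n \<subseteq> form L ?B n" by blast
      show "fin_sat U (carr U) n (p \<inter> form L ?B n)"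
        using p_type unfolding types_def fin_sat_def by blast
    qed
    then show "\<exists>x. P d i x" unfolding P_def by blast
  qed
  then show ?thesis using p_invariant unfolding P_def morley_sequence_def by blast
qed

end

section \<open>Exchanging members of a Morley sequence for tuples of \<open>A\<close>\<close>

locale fs_type_morley = fs_type L U A n p
  for L :: "('f, 'r) lang" and U :: "('f, 'r, 'u) struct" and A :: "'u set" and n p +
  fixes d :: "nat \<Rightarrow> 'u list"
  assumes morley: "morley_sequence L U A n p d"
begin

text \<open>Contains all parameters that arise while members of \<open>d\<close> are exchanged for
  tuples of \<open>A\<close>. It is countable, so only countably many formulas of \<open>p\<close>
  have to be controlled.\<close>

definition base :: "'u set" where "base = A \<union> (\<Union>j. set (d j))"

lemma d_in: "d i \<in> nlists n (carr U)"
  using morley by (auto simp: morley_sequence_def)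

lemma length_d [simp]: "length (d i) = n"
  using d_in[of i] by simp

lemma base_sub: "base \<subseteq> carr U"
  using A_sub d_in by (auto simp: base_def)

lemma countable_base: "countable base"
  using countable_A by (auto simp: base_def intro: countable_finite)

lemma morley_holds:
  assumes "\<theta> \<in> form L (A \<union> (\<Union>j<i. set (d j))) n"
  shows "holds U \<theta> (d i) \<longleftrightarrow> \<theta> \<in> p"
proof -
  have "A \<union> (\<Union>j<i. set (d j)) \<subseteq> carr U" using base_sub by (auto simp: base_def)
  then have "\<theta> \<in> form L (carr U) n" using assms form_mono by blast
  moreover have "holds U \<psi> (d i)" if "\<psi> \<in> p" "\<psi> \<in> form L (A \<union> (\<Union>j<i. set (d j))) n" for \<psi>
    using morley that by (auto simp: morley_sequence_def)
  ultimately show ?thesis using assms p_Neg by fastforce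
qed

text \<open>One exchange: left of \<open>d i\<close> stand earlier members, right of it tuples of
  \<open>A\<close>. The condition on the middle block thus has parameters over which
  \<open>d i\<close> realizes \<open>p\<close>, and hence belongs to \<open>p\<close>.\<close>

lemma plug_block:
  assumes "\<phi> \<in> form L A (n * r)" "set hs \<subseteq> nlists n A" "length js + 1 + length hs = r"
    and "\<And>j. j \<in> set js \<Longrightarrow> j < i"
    and "holds U \<phi> (concat (map d js @ d i # hs))"
  obtains \<theta> where "\<theta> \<in> p" "\<theta> \<in> form L base n"
    "\<And>x. length x = n \<Longrightarrow> holds U \<theta> x \<longleftrightarrow> holds U \<phi> (concat (map d js @ x # hs))"
proof -
  let ?a = "concat (map d js)" and ?b = "concat hs"
  let ?B = "A \<union> (\<Union>j<i. set (d j))"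
  have "length ?a = n * length (map d js)" by (rule length_concat_blocks) auto
  moreover have "length ?b = n * length hs" by (rule length_concat_blocks) (use assms(2) in auto)
  ultimately have len: "length ?a = n * length js" "length ?b = n * length hs" by simp_all
  have sub: "set ?a \<union> set ?b \<union> A \<subseteq> ?B"
    using assms(2,4) by (auto simp: subset_iff)
  have "length ?a + n + length ?b = n * r"
    unfolding len assms(3)[symmetric] by (simp add: algebra_simps)
  then have "\<phi> \<in> form L A (length ?a + n + length ?b)" using assms(1) by simp
  from form_plug[OF this sub] obtain \<theta> where \<theta>: "\<theta> \<in> form L ?B n"
    "\<And>S x. length x = n \<Longrightarrow> holds S \<theta> x \<longleftrightarrow> holds S \<phi> (?a @ x @ ?b)"
    by metis
  have "holds U \<theta> (d i)" using \<theta>(2) assms(5) by simp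
  then have "\<theta> \<in> p" using morley_holds[OF \<theta>(1)] by simp
  moreover have "\<theta> \<in> form L base n"
    using \<theta>(1) form_mono[of ?B base L n] by (auto simp: base_def)
  ultimately show thesis using that \<theta>(2) by simp
qed

text \<open>The members of the Morley sequence are replaced from the right to the left, which reverses
  the order.\<close>

lemma descend:
  assumes "\<phi> \<in> form L A (n * r)" "sorted_wrt (<) js" "length js = r" "holds U \<phi> (concat (map d js))"
    and S: "\<And>hs \<theta>. \<theta> \<in> p \<Longrightarrow> \<theta> \<in> form L base n \<Longrightarrow>
      \<exists>l\<in>S hs. e l \<in> nlists n A \<and> holds U \<theta> (e l)"
  shows "\<exists>ls. length ls = r \<and> (\<forall>t<r. ls ! t \<in> S (take t ls)) \<and> e ` set ls \<subseteq> nlists n A \<and>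
    holds U \<phi> (concat (map e (rev ls)))"
proof -
  \<comment> \<open>After \<open>t\<close> exchanges the first \<open>r - t\<close> members remain.
    \<open>ls\<close> records the choices in the order in which they are made, so its first entry
    stands rightmost, and \<open>S\<close> may restrict each choice by the earlier ones.\<close>
  have "\<exists>ls. length ls = t \<and> (\<forall>i<t. ls ! i \<in> S (take i ls)) \<and> e ` set ls \<subseteq> nlists n A \<and>
      holds U \<phi> (concat (map d (take (r - t) js) @ map e (rev ls)))" if "t \<le> r" for t
    using that
  proof (induction t)
    case 0
    then show ?case using assms(3,4) by simp
  next
    case (Suc t)
    then obtain ls where ls: "length ls = t" "\<forall>i<t. ls ! i \<in> S (take i ls)"
      "e ` set ls \<subseteq> nlists n A" "holds U \<phi> (concat (map d (take (r - t) js) @ map e (rev ls)))"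
      by auto
    \<comment> \<open>The position in \<open>js\<close> of the member that is exchanged next, the
      rightmost one left.\<close>
    define q where "q = r - Suc t"
    have q: "r - t = Suc q" "q < length js" using Suc.prems assms(3) by (auto simp: q_def)
    have "take (r - t) js = take q js @ [js ! q]"
      using q by (simp add: take_Suc_conv_app_nth)
    then have h: "holds U \<phi> (concat (map d (take q js) @ d (js ! q) # map e (rev ls)))"
      using ls(4) by simp
    have lt: "j < js ! q" if "j \<in> set (take q js)" for j
      using that q(2) assms(2) by (auto simp: in_set_conv_nth sorted_wrt_iff_nth_less)
    have "length (take q js) + 1 + length (map e (rev ls)) = r"
      using q ls(1) Suc.prems assms(3) by (simp add: q_def)
    moreover have "set (map e (rev ls)) \<subseteq> nlists n A" using ls(3) by simp
    ultimately obtain \<theta> where \<theta>: "\<theta> \<in> p" "\<theta> \<in> form L base n" "\<And>x. length x = n \<Longrightarrow>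
        holds U \<theta> x \<longleftrightarrow> holds U \<phi> (concat (map d (take q js) @ x # map e (rev ls)))"
      using plug_block[OF assms(1) _ _ lt h] by blast
    obtain l where l: "l \<in> S ls" "e l \<in> nlists n A" "holds U \<theta> (e l)"
      using S[OF \<theta>(1,2)] by blast
    then have "holds U \<phi> (concat (map d (take (r - Suc t) js) @ map e (rev (ls @ [l]))))"
      using \<theta>(3) by (simp add: q_def)
    then show ?case
      using ls l by (intro exI[of _ "ls @ [l]"]) (auto simp: nth_append less_Suc_eq)
  qed
  from this[of r] show ?thesis by simp
qed

text \<open>For a given formula, position and tail of tuples already chosen, every late enough
  member of \<open>c\<close> can take the place of \<open>d j\<close>. A diagonal choice makes each
  new index late enough for the first formulas and all tails from earlier members. Indices decrease
  since exchanges run from right to left.\<close>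

lemma thin_out:
  assumes c: "\<forall>i. c i \<in> nlists n A"
    and ev: "\<forall>\<theta>\<in>p \<inter> form L base n. \<forall>\<^sub>F i in sequentially. holds U \<theta> (c i)"
  obtains s :: "nat \<Rightarrow> nat" where "strict_mono s"
    "\<forall>r. \<forall>\<phi>\<in>form L A (n * r). holds U \<phi> (concat (map d [0..<r])) \<longrightarrow>
      (\<exists>N. \<forall>ks. length ks = r \<longrightarrow> sorted_wrt (>) ks \<longrightarrow> set ks \<subseteq> {N..} \<longrightarrow>
        holds U \<phi> (concat (map (\<lambda>i. c (s i)) ks)))"
proof -
  let ?F = "SIGMA r:UNIV. form L A (n * r)"
  have "countable ?F" using countable_form[OF countable_L countable_A] by auto
  moreover have "?F \<noteq> {}"
  proof -
    have "Ex 0 (Eq (Var 0) (Var 0)) \<in> form L A (n * 0)" by (simp add: form_def)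
    then show ?thesis by blast
  qed
  \<comment> \<open>An enumeration of all pairs of a number of blocks and a formula over
    \<open>A\<close> in that many blocks.\<close>
  moreover define rf where "rf = from_nat_into ?F"
  ultimately have rf: "range rf = ?F"
    by (simp add: range_from_nat_into)
  define R where "R q = fst (rf q)" for q
  define F where "F q = snd (rf q)" for q
  have F: "F q \<in> form L A (n * R q)" for q
    using rf by (metis F_def R_def SigmaE2 prod.collapse rangeI)
  \<comment> \<open>The finitely many tasks at stage \<open>k\<close>: formula number
    \<open>q\<close> up to \<open>k\<close>, the place \<open>j\<close> to be filled, and a tail
    \<open>hs\<close> from \<open>c 0, ..., c k\<close> with which the formula still holds.\<close>
  define X where "X k = (SIGMA q:{..k}. SIGMA j:{..<R q}.
      {hs. set hs \<subseteq> c ` {..k} \<and> length hs = R q - Suc j \<and>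
        holds U (F q) (concat (map d [0..<j] @ d j # hs))})" for k
  have "\<forall>\<^sub>F i in sequentially. \<forall>(q, j, hs)\<in>X k. holds U (F q) (concat (map d [0..<j] @ c i # hs))" for k
  proof (rule eventually_ball_finite)
    have fin: "finite {hs. set hs \<subseteq> c ` {..k} \<and> length hs = m \<and> Q hs}" for m Q
      by (rule rev_finite_subset[OF finite_lists_length_eq[of "c ` {..k}" m]]) auto
    show "finite (X k)"
      unfolding X_def by (intro finite_SigmaI finite_atMost finite_lessThan fin)
    show "\<forall>x\<in>X k. \<forall>\<^sub>F i in sequentially.
        case x of (q, j, hs) \<Rightarrow> holds U (F q) (concat (map d [0..<j] @ c i # hs))"
    proof (clarify)
      fix q j hs assume "(q, j, hs) \<in> X k"
      then have X: "j < R q" "set hs \<subseteq> c ` {..k}" "length hs = R q - Suc j"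
        "holds U (F q) (concat (map d [0..<j] @ d j # hs))"
        by (auto simp: X_def)
      have "set hs \<subseteq> nlists n A" using X(2) c by blast
      then obtain \<theta> where \<theta>: "\<theta> \<in> p" "\<theta> \<in> form L base n" "\<And>x. length x = n \<Longrightarrow>
          holds U \<theta> x \<longleftrightarrow> holds U (F q) (concat (map d [0..<j] @ x # hs))"
        using plug_block[OF F, where hs = hs and js = "[0..<j]" and i = j] X by auto
      have "length (c i) = n" for i using c by simp
      then show "\<forall>\<^sub>F i in sequentially. holds U (F q) (concat (map d [0..<j] @ c i # hs))"
        using bspec[OF ev, of \<theta>] \<theta> by simp
    qed
  qed
  then obtain G where G: "\<And>k i q j hs. G k \<le> i \<Longrightarrow> (q, j, hs) \<in> X k \<Longrightarrow>
      holds U (F q) (concat (map d [0..<j] @ c i # hs))"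
    unfolding eventually_sequentially by (metis (mono_tags, lifting) case_prod_conv)
  \<comment> \<open>\<open>G (s i)\<close> settles all tasks whose tails come from members up to
    \<open>c (s i)\<close>, so \<open>c (s (Suc i))\<close> may be put to the left of all of
    these.\<close>
  define s where "s = rec_nat 0 (\<lambda>_ m. max (Suc m) (G m))"
  have s_Suc: "s (Suc i) = max (Suc (s i)) (G (s i))" for i by (simp add: s_def)
  have mono: "strict_mono s" by (simp add: strict_mono_Suc_iff s_Suc less_max_iff_disj)
  show thesis
  proof (rule that[OF mono], intro allI ballI impI)
    fix r \<phi> assume \<phi>: "\<phi> \<in> form L A (n * r)" "holds U \<phi> (concat (map d [0..<r]))"
    then have "(r, \<phi>) \<in> range rf" using rf by simp
    then obtain q where "rf q = (r, \<phi>)" by (metis rangeE)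
    then have q: "R q = r" "F q = \<phi>" by (simp_all add: R_def F_def)
    show "\<exists>N. \<forall>ks. length ks = r \<longrightarrow> sorted_wrt (>) ks \<longrightarrow> set ks \<subseteq> {N..} \<longrightarrow>
        holds U \<phi> (concat (map (\<lambda>i. c (s i)) ks))"
    \<comment> \<open>Indices from \<open>Suc q\<close> on have the form \<open>Suc i\<close> with
      \<open>q \<le> i \<le> s i\<close>, so formula number \<open>q\<close> is among the tasks at
      stage \<open>s i\<close>.\<close>
    proof (intro exI[of _ "Suc q"] allI impI)
      fix ks assume ks: "length ks = r" "sorted_wrt (>) ks" "set ks \<subseteq> {Suc q..}"
      have "holds U \<phi> (concat (map d [0..<r - t] @ map (\<lambda>i. c (s i)) (drop (r - t) ks)))" if "t \<le> r" for t
        using that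
      proof (induction t)
        case 0
        then show ?case using \<phi>(2) ks(1) by simp
      next
        case (Suc t)
        define j where "j = r - Suc t"
        have j: "r - t = Suc j" "j < r" using Suc.prems by (auto simp: j_def)
        let ?hs = "map (\<lambda>i. c (s i)) (drop (Suc j) ks)"
        have "ks ! j \<in> {Suc q..}" using ks(1,3) j(2) nth_mem[of j ks] by blast
        then have "Suc q \<le> ks ! j" by simp
        then obtain i where i: "ks ! j = Suc i" "q \<le> i" by (cases "ks ! j") auto
        have "s k \<le> s i" if "k \<in> set (drop (Suc j) ks)" for k
        proof -
          from that obtain m where "m < length ks - Suc j" "k = ks ! (Suc j + m)"
            by (auto simp: in_set_conv_nth)
          then have "k < ks ! j" using ks(2) by (auto simp: sorted_wrt_iff_nth_less)
          then show ?thesis using i(1) mono by (simp add: strict_mono_less_eq)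
        qed
        moreover have "q \<le> s i" using i(2) strict_mono_imp_increasing[OF mono, of i] by simp
        ultimately have "(q, j, ?hs) \<in> X (s i)"
          using Suc j q ks(1) by (auto simp: X_def)
        then have "holds U (F q) (concat (map d [0..<j] @ c (s (Suc i)) # ?hs))"
          by (rule G[rotated]) (simp add: s_Suc)
        then have "holds U \<phi> (concat (map d [0..<j] @ c (s (ks ! j)) # ?hs))"
          unfolding q(2) i(1) .
        moreover have "drop j ks = ks ! j # drop (Suc j) ks"
          using j(2) ks(1) by (simp add: Cons_nth_drop_Suc)
        ultimately show ?case by (simp add: j_def)
      qed
      from this[of r] show "holds U \<phi> (concat (map (\<lambda>i. c (s i)) ks))" by simp
    qed
  qed
qed

end

section \<open>Sequences approximating a type\<close>

text \<open>\<open>p\<close> is an accumulation point of the types of the \<open>c i\<close> in the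
  Stone space; infinitely many indices are required, while the tuples may repeat.\<close>

definition adherent :: "('f, 'r, 'u) struct \<Rightarrow> (nat \<Rightarrow> 'u list) \<Rightarrow> ('f, 'r, 'u) fm set \<Rightarrow> bool" where
  "adherent U c p \<longleftrightarrow> (\<forall>\<Delta>. finite \<Delta> \<longrightarrow> \<Delta> \<subseteq> p \<longrightarrow> (\<exists>\<^sub>\<infinity>i. \<forall>\<phi>\<in>\<Delta>. holds U \<phi> (c i)))"

context fs_type
begin

text \<open>Diagonal choice: the \<open>i\<close>-th index is taken beyond the previous one and
  satisfies the formulas of \<open>\<Theta>\<close> numbered up to \<open>i\<close>.\<close>

lemma adherent_subsequence:
  fixes c :: "nat \<Rightarrow> 'u list"
  assumes c: "adherent U c p" and \<Theta>: "countable \<Theta>" "\<Theta> \<subseteq> p"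
  obtains s where "strict_mono s" "\<forall>\<theta>\<in>\<Theta>. \<forall>\<^sub>F i in sequentially. holds U \<theta> (c (s i))"
proof (cases "\<Theta> = {}")
  case True
  then show thesis using that[of id] by (simp add: strict_mono_def)
next
  case False
  define \<theta> where "\<theta> = from_nat_into \<Theta>"
  have \<theta>: "range \<theta> = \<Theta>" using False \<Theta>(1) by (simp add: \<theta>_def range_from_nat_into)
  have inf: "\<exists>k>m. \<forall>j\<le>i. holds U (\<theta> j) (c k)" for i m :: nat
  proof -
    have "\<theta> ` {..i} \<subseteq> p" using \<theta> \<Theta>(2) by blast
    then have "\<exists>\<^sub>\<infinity>k. \<forall>\<phi>\<in>\<theta> ` {..i}. holds U \<phi> (c k)"
      using c unfolding adherent_def by blast
    then show ?thesis unfolding INFM_nat by (metis atMost_iff imageI)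
  qed
  have "\<exists>s. \<forall>i. (\<forall>j\<le>i. holds U (\<theta> j) (c (s i))) \<and> s i < s (Suc i)"
  proof (rule dependent_nat_choice)
    show "\<exists>k. \<forall>j\<le>0. holds U (\<theta> j) (c k)" using inf by blast
    show "\<exists>k'. (\<forall>j\<le>Suc i. holds U (\<theta> j) (c k')) \<and> k < k'" for k i using inf by blast
  qed
  then obtain s where s: "\<And>i j. j \<le> i \<Longrightarrow> holds U (\<theta> j) (c (s i))" "\<And>i. s i < s (Suc i)"
    by blast
  show thesis
  proof (rule that)
    show "strict_mono s" using s(2) by (simp add: strict_mono_Suc_iff)
    show "\<forall>\<psi>\<in>\<Theta>. \<forall>\<^sub>F i in sequentially. holds U \<psi> (c (s i))"
    proof
      fix \<psi> assume "\<psi> \<in> \<Theta>"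
      with \<theta> obtain j where "\<psi> = \<theta> j" by auto
      then show "\<forall>\<^sub>F i in sequentially. holds U \<psi> (c (s i))"
        using s(1) by (auto simp: eventually_sequentially)
    qed
  qed
qed

text \<open>Every tuple in \<open>A\<close> is listed infinitely often.\<close>

lemma adherent_sequence:
  obtains c :: "nat \<Rightarrow> 'u list" where "\<forall>i. c i \<in> nlists n A" "adherent U c p"
proof -
  define e where "e = from_nat_into (nlists n A)"
  have "nlists n A \<subseteq> lists A" by auto
  then have "countable (nlists n A)" using countable_A countable_lists countable_subset by blast
  moreover have "nlists n A \<noteq> {}" using nlists_not_empty[OF A_nonempty] by blast
  ultimately have e: "range e = nlists n A" unfolding e_def by (simp add: range_from_nat_into)
  define c where "c i = e (fst (prod_decode i))" for i
  show thesis
  proof (rule that)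
    show "\<forall>i. c i \<in> nlists n A" using e by (auto simp: c_def simp del: in_nlists_iff)
    show "adherent U c p"
      unfolding adherent_def
    proof (intro allI impI)
      fix \<Delta> assume "finite \<Delta>" "\<Delta> \<subseteq> p"
      then obtain a where "a \<in> nlists n A" "\<forall>\<phi>\<in>\<Delta>. holds U \<phi> a" using p_finite by blast
      then obtain m where m: "\<forall>\<phi>\<in>\<Delta>. holds U \<phi> (e m)" using e by (metis rangeE)
      have "infinite (range (\<lambda>j :: nat. prod_encode (m, j)))"
        by (rule range_inj_infinite) (auto simp: inj_on_def)
      moreover have "range (\<lambda>j. prod_encode (m, j)) \<subseteq> {i. \<forall>\<phi>\<in>\<Delta>. holds U \<phi> (c i)}"
        using m by (auto simp: c_def)
      ultimately show "\<exists>\<^sub>\<infinity>i. \<forall>\<phi>\<in>\<Delta>. holds U \<phi> (c i)"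
        using infinite_super unfolding frequently_cofinite by blast
    qed
  qed
qed

end

text \<open>Compactness of the Stone space by Zorn's lemma: adherence has finite character, and a
  maximal adherent set of formulas is complete. Finite satisfiability in \<open>A\<close> follows as
  the \<open>c i\<close> lie there.\<close>

lemma (in countable_subset) adherent_type:
  fixes c :: "nat \<Rightarrow> 'u list"
  assumes c: "\<And>i. c i \<in> nlists n A"
  obtains p where "p \<in> types L U (carr U) n" "fin_sat U A n p" "adherent U c p"
proof -
  let ?Q = "{q. q \<subseteq> form L (carr U) n \<and> adherent U c q}"
  have "\<exists>p\<in>?Q. \<forall>q\<in>?Q. p \<subseteq> q \<longrightarrow> q = p"
  proof (rule subset_Zorn_nonempty)
    have "{} \<in> ?Q" by (simp add: adherent_def)
    then show "?Q \<noteq> {}" by blast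
    fix C assume C: "C \<noteq> {}" "subset.chain ?Q C"
    have "adherent U c (\<Union>C)"
      unfolding adherent_def
    proof (intro allI impI)
      fix \<Delta> assume "finite \<Delta>" "\<Delta> \<subseteq> \<Union>C"
      then obtain X where "X \<in> C" "\<Delta> \<subseteq> X" using C finite_subset_Union_chain by metis
      moreover have "adherent U c X" using \<open>X \<in> C\<close> C(2) by (auto simp: subset.chain_def)
      ultimately show "\<exists>\<^sub>\<infinity>i. \<forall>\<phi>\<in>\<Delta>. holds U \<phi> (c i)"
        using \<open>finite \<Delta>\<close> by (auto simp: adherent_def)
    qed
    then show "\<Union>C \<in> ?Q" using C(2) by (auto simp: subset.chain_def)
  qed
  then obtain p where "p \<in> ?Q" "\<forall>q\<in>?Q. p \<subseteq> q \<longrightarrow> q = p"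
    by (elim bexE)
  then have p: "p \<subseteq> form L (carr U) n" "adherent U c p"
    "\<And>q. q \<subseteq> form L (carr U) n \<Longrightarrow> adherent U c q \<Longrightarrow> p \<subseteq> q \<Longrightarrow> q = p"
    by auto
  have fs: "fin_sat U A n p"
    unfolding fin_sat_def
  proof (intro allI impI, elim conjE)
    fix \<Delta> assume "finite \<Delta>" "\<Delta> \<subseteq> p"
    then have "\<exists>\<^sub>\<infinity>i. \<forall>\<phi>\<in>\<Delta>. holds U \<phi> (c i)" using p(2) by (simp add: adherent_def)
    then obtain i where "\<forall>\<phi>\<in>\<Delta>. holds U \<phi> (c i)" using frequently_ex by blast
    then show "\<exists>a\<in>nlists n A. \<forall>\<phi>\<in>\<Delta>. holds U \<phi> a" using c by blast
  qed
  have "\<phi> \<in> p \<or> Neg \<phi> \<in> p" if \<phi>: "\<phi> \<in> form L (carr U) n" for \<phi>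
  proof (rule ccontr)
    assume "\<not> ?thesis"
    moreover have "\<not> adherent U c (insert \<psi> p)" if "\<psi> \<in> form L (carr U) n" "\<psi> \<notin> p" for \<psi>
    proof
      assume "adherent U c (insert \<psi> p)"
      then have "insert \<psi> p = p" by (rule p(3)[rotated]) (use p(1) that(1) in auto)
      then show False using that(2) by blast
    qed
    ultimately have "\<not> adherent U c (insert \<phi> p)" "\<not> adherent U c (insert (Neg \<phi>) p)"
      using \<phi> by simp_all
    moreover have "\<exists>\<Delta>. finite \<Delta> \<and> \<Delta> \<subseteq> q \<and> \<not> (\<exists>\<^sub>\<infinity>i. \<forall>\<psi>\<in>\<Delta>. holds U \<psi> (c i))" if "\<not> adherent U c q" for q
      using that unfolding adherent_def by simp
    ultimately obtain \<Delta>1 \<Delta>2 where \<Delta>: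
      "finite \<Delta>1" "\<Delta>1 \<subseteq> insert \<phi> p" "\<not> (\<exists>\<^sub>\<infinity>i. \<forall>\<psi>\<in>\<Delta>1. holds U \<psi> (c i))"
      "finite \<Delta>2" "\<Delta>2 \<subseteq> insert (Neg \<phi>) p" "\<not> (\<exists>\<^sub>\<infinity>i. \<forall>\<psi>\<in>\<Delta>2. holds U \<psi> (c i))"
      by meson
    \<comment> \<open>What the two witnesses of failure use from \<open>p\<close>. It holds at
      infinitely many indices, and at each of them \<open>\<phi>\<close> or its negation completes
      one of the two witnesses.\<close>
    define \<Delta> where "\<Delta> = (\<Delta>1 - {\<phi>}) \<union> (\<Delta>2 - {Neg \<phi>})"
    have "finite \<Delta>" "\<Delta> \<subseteq> p" using \<Delta> by (auto simp: \<Delta>_def)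
    then have "\<exists>\<^sub>\<infinity>i. \<forall>\<psi>\<in>\<Delta>. holds U \<psi> (c i)" using p(2) by (simp add: adherent_def)
    then have "\<exists>\<^sub>\<infinity>i. (\<forall>\<psi>\<in>\<Delta>1. holds U \<psi> (c i)) \<or> (\<forall>\<psi>\<in>\<Delta>2. holds U \<psi> (c i))"
    proof (rule frequently_elim1)
      fix i assume i: "\<forall>\<psi>\<in>\<Delta>. holds U \<psi> (c i)"
      have "holds U \<psi> (c i)" if "\<psi> \<in> \<Delta>1" "holds U \<phi> (c i)" for \<psi>
        using i that by (cases "\<psi> = \<phi>") (simp_all add: \<Delta>_def)
      moreover have "holds U \<psi> (c i)" if "\<psi> \<in> \<Delta>2" "\<not> holds U \<phi> (c i)" for \<psi>
        using i that by (cases "\<psi> = Neg \<phi>") (simp_all add: \<Delta>_def)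
      ultimately show "(\<forall>\<psi>\<in>\<Delta>1. holds U \<psi> (c i)) \<or> (\<forall>\<psi>\<in>\<Delta>2. holds U \<psi> (c i))"
        by meson
    qed
    then show False using \<Delta>(3,6) by (simp add: frequently_disj_iff)
  qed
  moreover have "fin_sat U (carr U) n p"
    unfolding fin_sat_def
  proof (intro allI impI)
    fix \<Delta> assume "finite \<Delta> \<and> \<Delta> \<subseteq> p"
    then have "\<exists>a\<in>nlists n A. \<forall>\<phi>\<in>\<Delta>. holds U \<phi> a" using fs unfolding fin_sat_def by simp
    then show "\<exists>a\<in>nlists n (carr U). \<forall>\<phi>\<in>\<Delta>. holds U \<phi> a"
      by (rule bexE) (use nlists_mono[OF A_sub] in blast)
  qed
  ultimately have "p \<in> types L U (carr U) n" using p(1) by (simp add: types_def)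
  then show thesis
    by (rule that[OF _ fs]) (rule p(2))
qed

lemma sorted_wrt_less_takeI:
  fixes ls :: "nat list"
  assumes "\<And>t j. t < length ls \<Longrightarrow> j \<in> set (take t ls) \<Longrightarrow> j < ls ! t"
  shows "sorted_wrt (<) ls"
  unfolding sorted_wrt_iff_nth_less
proof (intro allI impI)
  fix i j assume "i < j" "j < length ls"
  then have "ls ! i \<in> set (take j ls)" by (auto simp: in_set_conv_nth intro!: exI[of _ i])
  then show "ls ! i < ls ! j" using assms \<open>j < length ls\<close> by blast
qed

section \<open>Eventual NIP or DBSC-convergence makes Morley sequences converge\<close>

context fs_type_morley
begin

lemma approximating_subsequence:
  fixes c :: "nat \<Rightarrow> 'u list"
  assumes "adherent U c p"
  obtains s where "strict_mono s"
    "\<forall>\<theta>\<in>p \<inter> form L base n. \<forall>\<^sub>F i in sequentially. holds U \<theta> (c (s i))"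
proof -
  have "countable (p \<inter> form L base n)"
    using countable_form[OF countable_L countable_base] by (rule countable_subset[rotated]) auto
  then show thesis
    by (rule adherent_subsequence[OF assms]) (use that in blast)+
qed

text \<open>The pattern, with \<open>y\<close> existentially quantified, is a formula without
  parameters and thus survives the exchange of \<open>d\<close> for \<open>c\<close>. The tuple
  \<open>b\<close> is lost in favour of some \<open>y\<close>, and the pattern comes out
  reversed.\<close>

lemma transfer_pattern:
  assumes \<phi>: "\<phi> \<in> form L {} (n + k)" and b: "b \<in> nlists k (carr U)"
    and js: "sorted_wrt (<) js" "length js = r" "\<And>j. j < r \<Longrightarrow> holds U \<phi> (d (js ! j) @ b) = w j"
    and c: "\<And>i. c i \<in> nlists n A"
    and ev: "\<And>\<theta>. \<theta> \<in> p \<Longrightarrow> \<theta> \<in> form L base n \<Longrightarrow> \<forall>\<^sub>F i in sequentially. holds U \<theta> (c i)"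
  shows "\<exists>ls. sorted_wrt (<) ls \<and> length ls = r \<and>
    (\<exists>y\<in>nlists k (carr U). \<forall>t<r. holds U \<phi> (c (ls ! t) @ y) = w (r - Suc t))"
proof -
  obtain \<psi> where \<psi>: "\<psi> \<in> form L {} (n * r)"
    "\<And>xs. length xs = r \<Longrightarrow> (\<And>x. x \<in> set xs \<Longrightarrow> length x = n) \<Longrightarrow>
      holds U \<psi> (concat xs) \<longleftrightarrow> (\<exists>y\<in>nlists k (carr U). \<forall>j<r. holds U \<phi> (xs ! j @ y) = w j)"
    using form_pattern[OF carr_nonempty \<phi>, of r w] by metis
  have "holds U \<psi> (concat (map d js))"
    using b js(2,3) by (subst \<psi>(2)) (auto intro!: bexI[of _ b])
  moreover have "\<psi> \<in> form L A (n * r)" using \<psi>(1) form_mono[of "{}" A] by blast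
  ultimately have "\<exists>ls. length ls = r \<and> (\<forall>t<r. ls ! t \<in> {i. \<forall>j\<in>set (take t ls). j < i}) \<and>
      c ` set ls \<subseteq> nlists n A \<and> holds U \<psi> (concat (map c (rev ls)))"
  proof (intro descend[OF _ js(1,2)])
    fix hs \<theta> assume "\<theta> \<in> p" "\<theta> \<in> form L base n"
    \<comment> \<open>Each choice must exceed all earlier indices, so that \<open>ls\<close> becomes
      increasing.\<close>
    then have "\<forall>\<^sub>F i in sequentially. sum_list hs < i \<and> holds U \<theta> (c i)"
      using ev eventually_gt_at_top[of "sum_list hs"] by (simp add: eventually_conj_iff)
    then obtain i where i: "sum_list hs < i" "holds U \<theta> (c i)"
      using eventually_happens'[OF sequentially_bot] by blast
    have "j < i" if "j \<in> set hs" for j using member_le_sum_list[OF that] i(1) by simp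
    then show "\<exists>l\<in>{i. \<forall>j\<in>set hs. j < i}. c l \<in> nlists n A \<and> holds U \<theta> (c l)"
      using i(2) c by blast
  qed
  then obtain ls where ls: "length ls = r" "\<forall>t<r. ls ! t \<in> {i. \<forall>j\<in>set (take t ls). j < i}"
    "holds U \<psi> (concat (map c (rev ls)))"
    by (elim exE conjE) (rule that; assumption)
  have "holds U \<psi> (concat (map c (rev ls))) \<longleftrightarrow>
      (\<exists>y\<in>nlists k (carr U). \<forall>j<r. holds U \<phi> (map c (rev ls) ! j @ y) = w j)"
    using ls(1) c by (intro \<psi>(2)) auto
  then obtain y where y: "y \<in> nlists k (carr U)"
    "\<And>j. j < r \<Longrightarrow> holds U \<phi> (map c (rev ls) ! j @ y) = w j"
    using ls(3) by blast
  have "sorted_wrt (<) ls" using ls(1,2) by (intro sorted_wrt_less_takeI) auto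
  moreover have "holds U \<phi> (c (ls ! t) @ y) = w (r - Suc t)" if "t < r" for t
    using y(2)[of "r - Suc t"] that ls(1) by (simp add: rev_nth Suc_diff_Suc)
  ultimately show ?thesis using ls(1) y(1) by blast
qed

text \<open>If \<open>\<phi>(x, b)\<close> oscillates on \<open>d\<close>, every finite pattern
  occurs along \<open>d\<close> and hence along every subsequence of an approximating sequence,
  including the one from which eventual NIP excludes the pattern \<open>E\<close>.\<close>

lemma eventually_nip_imp_convergent:
  assumes "eventually_nip L U A"
  shows "tp_convergent L U n d"
proof (rule ccontr)
  assume nc: "\<not> ?thesis"
  obtain k b \<phi> where b: "b \<in> nlists k (carr U)" and \<phi>: "\<phi> \<in> form L {} (n + k)"
    and osc: "\<exists>\<^sub>\<infinity>i. holds U \<phi> (d i @ b)" "\<exists>\<^sub>\<infinity>i. \<not> holds U \<phi> (d i @ b)"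
    by (rule tp_convergent_oscillation[OF length_d nc])
  obtain c where c: "\<forall>i. c i \<in> nlists n A" "adherent U c p"
    by (rule adherent_sequence)
  obtain s where s: "strict_mono s"
    "\<forall>\<theta>\<in>p \<inter> form L base n. \<forall>\<^sub>F i in sequentially. holds U \<theta> (c (s i))"
    by (rule approximating_subsequence[OF c(2)])
  have "eventually_nip_formula U A n k \<phi>"
    using assms \<phi> form_mono[of "{}" "carr U"] unfolding eventually_nip_def by blast
  then have "\<exists>s' :: nat \<Rightarrow> nat. strict_mono s' \<and> (\<exists>r :: nat. \<exists>E\<subseteq>{1..r}. \<forall>i. strict_mono_on {1..r} i \<longrightarrow>
      \<not> (\<exists>y\<in>nlists k (carr U). (\<forall>j\<in>E. holds U \<phi> (c (s (s' (i j))) @ y)) \<and>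
        (\<forall>j\<in>{1..r} - E. \<not> holds U \<phi> (c (s (s' (i j))) @ y))))"
    unfolding eventually_nip_formula_def using c(1) by (elim allE[of _ "\<lambda>i. c (s i)"] impE) simp_all
  then obtain s' :: "nat \<Rightarrow> nat" and r :: nat and E where s': "strict_mono s'" and "E \<subseteq> {1..r}"
    and E: "\<forall>i. strict_mono_on {1..r} i \<longrightarrow>
      \<not> (\<exists>y\<in>nlists k (carr U). (\<forall>j\<in>E. holds U \<phi> (c (s (s' (i j))) @ y)) \<and>
        (\<forall>j\<in>{1..r} - E. \<not> holds U \<phi> (c (s (s' (i j))) @ y)))"
    by (elim exE conjE) (rule that; assumption)
  \<comment> \<open>The pattern is prescribed backwards, since the transfer reverses it. Position
    \<open>t\<close> of the resulting list then has the value \<open>Suc t \<in> E\<close>, which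
    fits the numbering of \<open>E\<close> from 1.\<close>
  obtain js where js: "sorted_wrt (<) js" "length js = r"
    "\<forall>j<r. holds U \<phi> (d (js ! j) @ b) = (r - j \<in> E)"
    using oscillating_list[OF osc, of r "\<lambda>j. r - j \<in> E"] by blast
  have "\<exists>ls. sorted_wrt (<) ls \<and> length ls = r \<and>
    (\<exists>y\<in>nlists k (carr U). \<forall>t<r. holds U \<phi> (c (s (s' (ls ! t))) @ y) = (r - (r - Suc t) \<in> E))"
  proof (rule transfer_pattern[OF \<phi> b js(1,2)])
    show "holds U \<phi> (d (js ! j) @ b) = (r - j \<in> E)" if "j < r" for j using js(3) that by blast
    show "c (s (s' i)) \<in> nlists n A" for i using c(1) by blast
    show "\<forall>\<^sub>F i in sequentially. holds U \<theta> (c (s (s' i)))" if "\<theta> \<in> p" "\<theta> \<in> form L base n" for \<theta>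
    proof -
      have "\<forall>\<^sub>F i in sequentially. holds U \<theta> (c (s i))" using s(2) that by blast
      from eventually_subseq[OF s' this] show ?thesis .
    qed
  qed
  then obtain ls y where ls: "sorted_wrt (<) ls" "length ls = r" and y: "y \<in> nlists k (carr U)"
    "\<forall>t<r. holds U \<phi> (c (s (s' (ls ! t))) @ y) = (r - (r - Suc t) \<in> E)"
    by (elim exE conjE bexE) (rule that; assumption)
  have val: "holds U \<phi> (c (s (s' (ls ! (j - 1)))) @ y) \<longleftrightarrow> j \<in> E" if "j \<in> {1..r}" for j
    using y(2)[rule_format, of "j - 1"] that by auto
  have sm: "strict_mono_on {1..r} (\<lambda>j. ls ! (j - 1))"
    using ls by (auto simp: strict_mono_on_def sorted_wrt_iff_nth_less)
  have "\<not> (\<exists>y\<in>nlists k (carr U). (\<forall>j\<in>E. holds U \<phi> (c (s (s' (ls ! (j - 1)))) @ y)) \<and>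
      (\<forall>j\<in>{1..r} - E. \<not> holds U \<phi> (c (s (s' (ls ! (j - 1)))) @ y)))"
    by (rule mp[OF spec[OF E, of "\<lambda>j. ls ! (j - 1)"] sm])
  moreover have "\<forall>j\<in>E. holds U \<phi> (c (s (s' (ls ! (j - 1)))) @ y)"
    using val \<open>E \<subseteq> {1..r}\<close> by blast
  moreover have "\<forall>j\<in>{1..r} - E. \<not> holds U \<phi> (c (s (s' (ls ! (j - 1)))) @ y)"
    using val by blast
  ultimately show False using y(1) by blast
qed

text \<open>An oscillation on \<open>d\<close> would carry over to \<open>c\<close> as an
  alternation of length \<open>N + 2\<close>, that is, to more than \<open>N\<close> changes for a
  single \<open>y\<close>.\<close>

lemma dbsc_imp_convergent:
  assumes c: "\<And>i. c i \<in> nlists n A" and dbsc: "dbsc_converges_to L U n c p"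
  shows "tp_convergent L U n d"
proof (rule ccontr)
  assume nc: "\<not> ?thesis"
  obtain k b \<phi> where b: "b \<in> nlists k (carr U)" and \<phi>: "\<phi> \<in> form L {} (n + k)"
    and osc: "\<exists>\<^sub>\<infinity>i. holds U \<phi> (d i @ b)" "\<exists>\<^sub>\<infinity>i. \<not> holds U \<phi> (d i @ b)"
    by (rule tp_convergent_oscillation[OF length_d nc])
  obtain N where N: "\<And>y K. y \<in> nlists k (carr U) \<Longrightarrow>
      card {l \<in> {..<K}. holds U \<phi> (c l @ y) \<noteq> holds U \<phi> (c (Suc l) @ y)} \<le> N"
    using dbsc \<phi> unfolding dbsc_converges_to_def dbsc_convergent_iff by blast
  obtain js where js: "sorted_wrt (<) js" "length js = N + 2"
    "\<forall>j<N + 2. holds U \<phi> (d (js ! j) @ b) = even j"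
    using oscillating_list[OF osc, of "N + 2" even] by blast
  have "\<exists>ls. sorted_wrt (<) ls \<and> length ls = N + 2 \<and>
    (\<exists>y\<in>nlists k (carr U). \<forall>t<N + 2. holds U \<phi> (c (ls ! t) @ y) = even (N + 2 - Suc t))"
  proof (rule transfer_pattern[OF \<phi> b js(1,2)])
    show "holds U \<phi> (d (js ! j) @ b) = even j" if "j < N + 2" for j using js(3) that by blast
    show "\<forall>\<^sub>F i in sequentially. holds U \<theta> (c i)" if "\<theta> \<in> p" for \<theta>
      using dbsc p_form[OF that] that unfolding dbsc_converges_to_def tp_converges_to_def by blast
  qed (rule c)
  then obtain ls y where ls: "sorted_wrt (<) ls" "length ls = N + 2" and y: "y \<in> nlists k (carr U)"
    "\<forall>t<N + 2. holds U \<phi> (c (ls ! t) @ y) = even (N + 2 - Suc t)"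
    by (elim exE conjE bexE) (rule that; assumption)
  have "length ls \<le> Suc (card {l \<in> {..<last ls}. holds U \<phi> (c l @ y) \<noteq> holds U \<phi> (c (Suc l) @ y)})"
  proof (rule many_changes[OF ls(1)])
    fix j assume "Suc j < length ls"
    then have "j < N + 2" "Suc j < N + 2" "N + 2 - Suc j = Suc (N + 2 - Suc (Suc j))" using ls(2) by auto
    then show "holds U \<phi> (c (ls ! Suc j) @ y) \<noteq> holds U \<phi> (c (ls ! j) @ y)"
      using y(2)[rule_format, of j] y(2)[rule_format, of "Suc j"] by simp
  qed (use ls(2) in auto)
  then show False using N[OF y(1), of "last ls"] ls(2) by simp
qed

end

section \<open>Convergent Morley sequences yield DBSC-convergence and eventual NIP\<close>

context fs_type_morley
begin

text \<open>Expresses the bound on alternation as one formula over \<open>A\<close> true of the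
  first \<open>r\<close> members of \<open>d\<close>, as required for exchanging them.\<close>

lemma Neg_pattern:
  assumes "\<phi> \<in> form L {} (n + k)"
    and "\<forall>y\<in>nlists k (carr U). \<exists>j<r. holds U \<phi> (d j @ y) \<noteq> even j"
  shows "\<exists>\<psi>\<in>form L A (n * r). holds U \<psi> (concat (map d [0..<r])) \<and>
    (\<forall>xs. length xs = r \<longrightarrow> set xs \<subseteq> nlists n A \<longrightarrow> holds U \<psi> (concat xs) \<longrightarrow>
      \<not> (\<exists>y\<in>nlists k (carr U). \<forall>j<r. holds U \<phi> (xs ! j @ y) = even j))"
proof -
  obtain \<psi> where \<psi>: "\<psi> \<in> form L {} (n * r)"
    "\<And>xs. length xs = r \<Longrightarrow> (\<And>x. x \<in> set xs \<Longrightarrow> length x = n) \<Longrightarrow>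
      holds U \<psi> (concat xs) \<longleftrightarrow> (\<exists>y\<in>nlists k (carr U). \<forall>j<r. holds U \<phi> (xs ! j @ y) = even j)"
    using form_pattern[OF carr_nonempty assms(1), of r even] by metis
  have "holds U \<psi> (concat (map d [0..<r])) \<longleftrightarrow>
      (\<exists>y\<in>nlists k (carr U). \<forall>j<r. holds U \<phi> (map d [0..<r] ! j @ y) = even j)"
    by (rule \<psi>(2)) auto
  moreover have "map d [0..<r] ! j = d j" if "j < r" for j using that by simp
  ultimately have "\<not> holds U \<psi> (concat (map d [0..<r]))"
    using assms(2) by metis
  moreover have "holds U \<psi> (concat xs) \<longleftrightarrow>
      (\<exists>y\<in>nlists k (carr U). \<forall>j<r. holds U \<phi> (xs ! j @ y) = even j)"
    if "length xs = r" "set xs \<subseteq> nlists n A" for xs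
    using that by (intro \<psi>(2)) auto
  moreover have "Neg \<psi> \<in> form L A (n * r)" using \<psi>(1) form_mono[of "{}" A] by auto
  ultimately show ?thesis by (intro bexI[of _ "Neg \<psi>"]) (auto simp del: in_nlists_iff)
qed

text \<open>If the limit of \<open>c\<close> disagreed with \<open>p\<close> on \<open>\<phi>(x, b)\<close>, then alternately realizing \<open>p\<close> and
  choosing elements of \<open>c\<close> would give a sequence on which \<open>\<phi>(x, b)\<close> alternates.\<close>

lemma limit_unique:
  assumes conv: "tp_convergent L U n d" and c: "\<forall>i. c i \<in> nlists n A"
    and ev: "\<forall>\<theta>\<in>p \<inter> form L base n. \<forall>\<^sub>F i in sequentially. holds U \<theta> (c i)"
    and \<chi>: "\<chi> \<in> p"
  shows "\<not> (\<forall>\<^sub>F i in sequentially. \<not> holds U \<chi> (c i))"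
proof
  assume neg: "\<forall>\<^sub>F i in sequentially. \<not> holds U \<chi> (c i)"
  obtain k b \<phi> where b: "b \<in> nlists k (carr U)" and \<phi>: "\<phi> \<in> form L {} (n + k)"
    "\<And>S x. length x = n \<Longrightarrow> holds S \<phi> (x @ b) \<longleftrightarrow> holds S \<chi> x"
    using form_separate_params[OF p_form[OF \<chi>]] by metis
  obtain r where r: "\<forall>y\<in>nlists k (carr U). \<exists>j<r. holds U \<phi> (d j @ y) \<noteq> even j"
    by (rule bounded_alternation[OF d_in conv \<phi>(1)])
  obtain \<psi> where \<psi>: "\<psi> \<in> form L A (n * r)" "holds U \<psi> (concat (map d [0..<r]))"
    "\<forall>xs. length xs = r \<longrightarrow> set xs \<subseteq> nlists n A \<longrightarrow> holds U \<psi> (concat xs) \<longrightarrow>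
      \<not> (\<exists>y\<in>nlists k (carr U). \<forall>j<r. holds U \<phi> (xs ! j @ y) = even j)"
    using Neg_pattern[OF \<phi>(1) r] by (elim bexE conjE) (rule that; assumption)
  \<comment> \<open>Here the tuples themselves are chosen, hence \<open>id\<close>. The tuple chosen
    after \<open>hs\<close> ends up at position \<open>r - Suc (length hs)\<close> once the list is
    reversed, and the parity of that position decides whether \<open>\<chi>\<close> should
    hold.\<close>
  have "\<exists>ls. length ls = r \<and>
      (\<forall>t<r. ls ! t \<in> {a. holds U \<chi> a = even (r - Suc (length (take t ls)))}) \<and>
      id ` set ls \<subseteq> nlists n A \<and> holds U \<psi> (concat (map id (rev ls)))"
  proof (rule descend[OF \<psi>(1) _ _ \<psi>(2)])
    fix hs :: "'u list list" and \<theta> assume \<theta>: "\<theta> \<in> p" "\<theta> \<in> form L base n"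
    show "\<exists>l\<in>{a. holds U \<chi> a = even (r - Suc (length hs))}. id l \<in> nlists n A \<and> holds U \<theta> (id l)"
    proof (cases "even (r - Suc (length hs))")
      case True
      have "\<exists>a\<in>nlists n A. \<forall>\<phi>\<in>{\<theta>, \<chi>}. holds U \<phi> a"
        using \<theta>(1) \<chi> by (intro p_finite) auto
      then obtain a where "a \<in> nlists n A" "\<forall>\<phi>\<in>{\<theta>, \<chi>}. holds U \<phi> a"
        by (elim bexE) (rule that; assumption)
      then show ?thesis using True by (intro bexI[of _ a]) auto
    next
      case False
      have "\<forall>\<^sub>F i in sequentially. \<not> holds U \<chi> (c i) \<and> holds U \<theta> (c i)"
        using neg ev \<theta> by (intro eventually_conj) blast+
      then obtain i where "\<not> holds U \<chi> (c i)" "holds U \<theta> (c i)"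
        using eventually_happens'[OF sequentially_bot] by blast
      then show ?thesis using False c by (intro bexI[of _ "c i"]) auto
    qed
  qed (auto simp: sorted_wrt_upt)
  then obtain ls where ls: "length ls = r"
    "\<forall>t<r. ls ! t \<in> {a. holds U \<chi> a = even (r - Suc (length (take t ls)))}"
    "id ` set ls \<subseteq> nlists n A" "holds U \<psi> (concat (map id (rev ls)))"
    by (elim exE conjE) (rule that; assumption)
  have "holds U \<phi> (rev ls ! j @ b) = even j" if "j < r" for j
  proof -
    define t where "t = r - Suc j"
    have t: "t < r" "r - Suc t = j" using that by (auto simp: t_def)
    have "rev ls ! j = ls ! t" using that ls(1) by (simp add: rev_nth t_def)
    moreover have "length (take t ls) = t" using ls(1) t(1) by simp
    then have "ls ! t \<in> {a. holds U \<chi> a = even j}" using ls(2) t by metis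
    moreover have "length (ls ! t) = n" using ls(1,3) t(1) nth_mem[of t ls] by fastforce
    ultimately show ?thesis using \<phi>(2) by simp
  qed
  moreover have "length (rev ls) = r" "set (rev ls) \<subseteq> nlists n A" "holds U \<psi> (concat (rev ls))"
    using ls(1,3,4) by (simp_all del: in_nlists_iff)
  ultimately show False using \<psi>(3) b by blast
qed

text \<open>Thin out a sequence in \<open>A\<close> that approximates \<open>p\<close> over
  \<open>base\<close>. The excluded alternation bounds the number of changes; bounded change makes
  the types converge, and limit_unique identifies the limit as \<open>p\<close>.\<close>

lemma convergent_imp_dbsc:
  assumes conv: "tp_convergent L U n d"
  shows "\<exists>c. (\<forall>i. c i \<in> nlists n A) \<and> dbsc_converges_to L U n c p"
proof -
  obtain c\<^sub>0 where c0: "\<forall>i. c\<^sub>0 i \<in> nlists n A" "adherent U c\<^sub>0 p"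
    by (rule adherent_sequence)
  obtain s where s: "strict_mono s"
    "\<forall>\<theta>\<in>p \<inter> form L base n. \<forall>\<^sub>F i in sequentially. holds U \<theta> (c\<^sub>0 (s i))"
    by (rule approximating_subsequence[OF c0(2)])
  obtain s' :: "nat \<Rightarrow> nat" where s': "strict_mono s'"
    "\<forall>r. \<forall>\<phi>\<in>form L A (n * r). holds U \<phi> (concat (map d [0..<r])) \<longrightarrow>
      (\<exists>N. \<forall>ks. length ks = r \<longrightarrow> sorted_wrt (>) ks \<longrightarrow> set ks \<subseteq> {N..} \<longrightarrow>
        holds U \<phi> (concat (map (\<lambda>i. c\<^sub>0 (s (s' i))) ks)))"
    by (rule thin_out[OF _ s(2)]) (use c0(1) in blast)
  define c where "c i = c\<^sub>0 (s (s' i))" for i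
  have c: "\<forall>i. c i \<in> nlists n A" using c0(1) unfolding c_def by blast
  have "\<forall>\<theta>\<in>p \<inter> form L base n. \<forall>\<^sub>F i in sequentially. holds U \<theta> (c i)"
    using s(2) eventually_subseq[OF s'(1)] unfolding c_def by blast
  note limit = limit_unique[OF conv c this]
  have changes: "\<exists>N. \<forall>b\<in>nlists k (carr U). \<forall>K.
      card {l \<in> {..<K}. holds U \<phi> (c l @ b) \<noteq> holds U \<phi> (c (Suc l) @ b)} \<le> N"
    if \<phi>: "\<phi> \<in> form L {} (n + k)" for k \<phi>
  proof -
    obtain r where r: "\<forall>y\<in>nlists k (carr U). \<exists>j<r. holds U \<phi> (d j @ y) \<noteq> even j"
      by (rule bounded_alternation[OF d_in conv \<phi>])
    obtain \<psi> where \<psi>: "\<psi> \<in> form L A (n * r)" "holds U \<psi> (concat (map d [0..<r]))"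
      "\<forall>xs. length xs = r \<longrightarrow> set xs \<subseteq> nlists n A \<longrightarrow> holds U \<psi> (concat xs) \<longrightarrow>
        \<not> (\<exists>y\<in>nlists k (carr U). \<forall>j<r. holds U \<phi> (xs ! j @ y) = even j)"
      using Neg_pattern[OF \<phi> r] by (elim bexE conjE) (rule that; assumption)
    obtain N where N: "\<forall>ks. length ks = r \<longrightarrow> sorted_wrt (>) ks \<longrightarrow> set ks \<subseteq> {N..} \<longrightarrow>
        holds U \<psi> (concat (map c ks))"
      using bspec[OF spec[OF s'(2)] \<psi>(1)] \<psi>(2) unfolding c_def by blast
    have "card {l \<in> {..<K}. holds U \<phi> (c l @ b) \<noteq> holds U \<phi> (c (Suc l) @ b)} \<le> N + r"
      if b: "b \<in> nlists k (carr U)" for b K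
    \<comment> \<open>The excluded pattern starts with truth on decreasing indices. Read in
      increasing order it starts with the value belonging to position \<open>r - 1\<close>.\<close>
    proof (rule few_changes[where b = "even (r - 1)"])
      fix ks :: "nat list"
      assume ks: "sorted_wrt (<) ks" "length ks = r" "set ks \<subseteq> {N..}"
      show "\<exists>j<r. holds U \<phi> (c (ks ! j) @ b) \<noteq> (even j \<longleftrightarrow> even (r - 1))"
      proof (rule ccontr)
        assume "\<not> ?thesis"
        then have *: "holds U \<phi> (c (ks ! j) @ b) \<longleftrightarrow> (even j \<longleftrightarrow> even (r - 1))" if "j < r" for j
          using that by blast
        have "holds U \<phi> (map c (rev ks) ! j @ b) = even j" if "j < r" for j
        proof -
          have "even (r - Suc j) \<longleftrightarrow> (even j \<longleftrightarrow> even (r - 1))" using that by auto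
          then show ?thesis using *[of "r - Suc j"] that ks(2) by (auto simp: rev_nth)
        qed
        moreover have "holds U \<psi> (concat (map c (rev ks)))"
          using N ks by (simp add: sorted_wrt_rev)
        moreover have "set (map c (rev ks)) \<subseteq> nlists n A" using c by (auto simp del: in_nlists_iff)
        moreover have "length (map c (rev ks)) = r" using ks(2) by simp
        ultimately show False using \<psi>(3) b by blast
      qed
    qed
    then show ?thesis by blast
  qed
  have tp: "(\<forall>\<^sub>F i in sequentially. holds U \<chi> (c i)) \<or> (\<forall>\<^sub>F i in sequentially. \<not> holds U \<chi> (c i))"
    if \<chi>: "\<chi> \<in> form L (carr U) n" for \<chi>
  proof -
    obtain k b \<phi> where b: "b \<in> nlists k (carr U)" and \<phi>: "\<phi> \<in> form L {} (n + k)"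
      "\<And>S x. length x = n \<Longrightarrow> holds S \<phi> (x @ b) \<longleftrightarrow> holds S \<chi> x"
      using form_separate_params[OF \<chi>] by metis
    obtain N where N: "\<forall>b\<in>nlists k (carr U). \<forall>K.
        card {l \<in> {..<K}. holds U \<phi> (c l @ b) \<noteq> holds U \<phi> (c (Suc l) @ b)} \<le> N"
      using changes[OF \<phi>(1)] by (elim exE) (rule that; assumption)
    have "(\<forall>\<^sub>F i in sequentially. holds U \<phi> (c i @ b)) \<or>
        (\<forall>\<^sub>F i in sequentially. \<not> holds U \<phi> (c i @ b))"
      by (rule bounded_changes_imp_eventually_constant[OF spec[OF bspec[OF N b]]])
    moreover have "holds U \<phi> (c i @ b) \<longleftrightarrow> holds U \<chi> (c i)" for i using c by (intro \<phi>(2)) simp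
    ultimately show ?thesis by simp
  qed
  \<comment> \<open>Applied to \<open>\<chi>\<close> and to its negation, the uniqueness of the
    limit settles both cases of completeness.\<close>
  have "\<chi> \<in> p \<longleftrightarrow> (\<forall>\<^sub>F i in sequentially. holds U \<chi> (c i))" if "\<chi> \<in> form L (carr U) n" for \<chi>
    using limit[of \<chi>] limit[of "Neg \<chi>"] tp[OF that] p_Neg[OF that] by auto
  then have "dbsc_converges_to L U n c p"
    unfolding dbsc_converges_to_def dbsc_convergent_iff tp_converges_to_def tp_convergent_def
    using changes tp by blast
  then show ?thesis using c by blast
qed

end

text \<open>The given sequence has an accumulation type \<open>p\<close>, finitely satisfiable in
  \<open>A\<close>. A subsequence thinned out along a convergent Morley sequence of \<open>p\<close>
  omits the alternating pattern of length \<open>r\<close>.\<close>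

lemma (in countable_subset) convergent_imp_eventually_nip:
  assumes conv: "\<And>n p. p \<in> types L U (carr U) n \<Longrightarrow> fin_sat U A n p \<Longrightarrow>
    \<exists>d. morley_sequence L U A n p d \<and> tp_convergent L U n d"
  shows "eventually_nip L U A"
  unfolding eventually_nip_def eventually_nip_formula_def
proof (intro allI ballI impI)
  fix m k \<chi> and c :: "nat \<Rightarrow> 'u list"
  assume \<chi>: "\<chi> \<in> form L (carr U) (m + k)" and c: "\<forall>i. c i \<in> nlists m A"
  obtain l b \<phi> where b: "b \<in> nlists l (carr U)" and \<phi>: "\<phi> \<in> form L {} (m + k + l)"
    "\<And>S x. length x = m + k \<Longrightarrow> holds S \<phi> (x @ b) \<longleftrightarrow> holds S \<chi> x"
    using form_separate_params[OF \<chi>] by metis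
  \<comment> \<open>The parameters of \<open>\<chi>\<close> join \<open>y\<close>, so that the bound
    on alternation is found for all values of both.\<close>
  have \<phi>': "\<phi> \<in> form L {} (m + (k + l))" using \<phi>(1) by (simp add: add.assoc)
  obtain p where p: "p \<in> types L U (carr U) m" "fin_sat U A m p" "adherent U c p"
    by (rule adherent_type[of c m]) (use c in blast)+
  obtain d where d: "morley_sequence L U A m p d" "tp_convergent L U m d"
    using conv[OF p(1,2)] by blast
  interpret fs_type_morley L U A m p d
    by unfold_locales (rule p d)+
  obtain s where s: "strict_mono s"
    "\<forall>\<theta>\<in>p \<inter> form L base m. \<forall>\<^sub>F i in sequentially. holds U \<theta> (c (s i))"
    by (rule approximating_subsequence[OF p(3)])
  obtain s' :: "nat \<Rightarrow> nat" where s': "strict_mono s'"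
    "\<forall>r. \<forall>\<phi>\<in>form L A (m * r). holds U \<phi> (concat (map d [0..<r])) \<longrightarrow>
      (\<exists>N. \<forall>ks. length ks = r \<longrightarrow> sorted_wrt (>) ks \<longrightarrow> set ks \<subseteq> {N..} \<longrightarrow>
        holds U \<phi> (concat (map (\<lambda>i. c (s (s' i))) ks)))"
    by (rule thin_out[OF _ s(2)]) (use c in blast)
  obtain r where r: "\<forall>y\<in>nlists (k + l) (carr U). \<exists>j<r. holds U \<phi> (d j @ y) \<noteq> even j"
    by (rule bounded_alternation[OF d_in d(2) \<phi>'])
  obtain \<psi> where \<psi>: "\<psi> \<in> form L A (m * r)" "holds U \<psi> (concat (map d [0..<r]))"
    "\<forall>xs. length xs = r \<longrightarrow> set xs \<subseteq> nlists m A \<longrightarrow> holds U \<psi> (concat xs) \<longrightarrow>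
      \<not> (\<exists>y\<in>nlists (k + l) (carr U). \<forall>j<r. holds U \<phi> (xs ! j @ y) = even j)"
    using Neg_pattern[OF \<phi>' r] by (elim bexE conjE) (rule that; assumption)
  obtain N where N: "\<forall>ks. length ks = r \<longrightarrow> sorted_wrt (>) ks \<longrightarrow> set ks \<subseteq> {N..} \<longrightarrow>
      holds U \<psi> (concat (map (\<lambda>i. c (s (s' i))) ks))"
    using bspec[OF spec[OF s'(2)] \<psi>(1)] \<psi>(2) by blast
  \<comment> \<open>Shifting by \<open>N\<close> makes all indices large enough, as eventual NIP
    demands the property of every increasing choice.\<close>
  define S where "S i = s (s' (i + N))" for i
  \<comment> \<open>The place \<open>t\<close> in increasing order, counted from 1, is the place
    \<open>r - t\<close> in decreasing order, counted from 0, where the alternation prescribes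
    \<open>even (r - t)\<close>.\<close>
  define E where "E = {t \<in> {1..r}. even (r - t)}"
  have nopat: "\<not> (\<exists>y\<in>nlists k (carr U). (\<forall>j\<in>E. holds U \<chi> (c (S (i j)) @ y)) \<and>
      (\<forall>j\<in>{1..r} - E. \<not> holds U \<chi> (c (S (i j)) @ y)))" if i: "strict_mono_on {1..r} i" for i
  proof
    assume "\<exists>y\<in>nlists k (carr U). (\<forall>j\<in>E. holds U \<chi> (c (S (i j)) @ y)) \<and>
      (\<forall>j\<in>{1..r} - E. \<not> holds U \<chi> (c (S (i j)) @ y))"
    then obtain y where y: "y \<in> nlists k (carr U)" "\<forall>j\<in>E. holds U \<chi> (c (S (i j)) @ y)"
      "\<forall>j\<in>{1..r} - E. \<not> holds U \<chi> (c (S (i j)) @ y)"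
      by blast
    define ks where "ks = map (\<lambda>j. i (r - j) + N) [0..<r]"
    let ?xs = "map (\<lambda>i. c (s (s' i))) ks"
    have "i (r - t') < i (r - t)" if "t < t'" "t' < r" for t t'
      using i that by (intro strict_mono_onD[OF i]) auto
    then have "sorted_wrt (>) ks" by (auto simp: ks_def sorted_wrt_iff_nth_less)
    moreover have "length ks = r" "set ks \<subseteq> {N..}" by (auto simp: ks_def)
    ultimately have \<psi>xs: "holds U \<psi> (concat ?xs)" using N by blast
    have sub: "set ?xs \<subseteq> nlists m A" using c by (auto simp del: in_nlists_iff)
    have len: "length ?xs = r" by (simp add: ks_def)
    have "holds U \<phi> (?xs ! j @ y @ b) = even j" if "j < r" for j
    proof -
      have "?xs ! j = c (S (i (r - j)))" using that by (simp add: ks_def S_def)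
      moreover have "length (c (S (i (r - j))) @ y) = m + k" using c y(1) by simp
      then have "holds U \<phi> ((c (S (i (r - j))) @ y) @ b) \<longleftrightarrow> holds U \<chi> (c (S (i (r - j))) @ y)"
        by (rule \<phi>(2))
      moreover have "r - j \<in> {1..r}" "r - (r - j) = j" using that by auto
      then have "r - j \<in> E \<longleftrightarrow> even j" by (simp only: E_def mem_Collect_eq simp_thms)
      ultimately show ?thesis using y(2,3) \<open>r - j \<in> {1..r}\<close> by (metis DiffI append_assoc)
    qed
    moreover have "y @ b \<in> nlists (k + l) (carr U)" using y(1) b by simp
    ultimately have "\<exists>y'\<in>nlists (k + l) (carr U). \<forall>j<r. holds U \<phi> (?xs ! j @ y') = even j"
      by (intro bexI[of _ "y @ b"] allI impI)
    then show False
      using mp[OF mp[OF mp[OF spec[OF \<psi>(3)] len] sub] \<psi>xs] by (rule notE[rotated])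
  qed
  have S: "strict_mono S"
    using s(1) s'(1) by (simp add: S_def strict_mono_def)
  have E: "E \<subseteq> {1..r}" by (auto simp: E_def)
  show "\<exists>s :: nat \<Rightarrow> nat. strict_mono s \<and> (\<exists>n :: nat. \<exists>E\<subseteq>{1..n}. \<forall>i. strict_mono_on {1..n} i \<longrightarrow>
      \<not> (\<exists>y\<in>nlists k (carr U). (\<forall>j\<in>E. holds U \<chi> (c (s (i j)) @ y)) \<and>
        (\<forall>j\<in>{1..n} - E. \<not> holds U \<chi> (c (s (i j)) @ y))))"
    using S E nopat by meson
qed

text \<open>Some Morley sequence always exists, and (i) or (ii) makes it converge. Conversely, a
  single convergent one gives (ii) for the same \<open>p\<close>, while (i) needs convergent ones
  for all types.\<close>

lemma (in countable_subset) equivalences: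
  "(eventually_nip L U A \<longleftrightarrow> (\<forall>n. \<forall>p\<in>types L U (carr U) n. fin_sat U A n p \<longrightarrow>
      (\<exists>c. (\<forall>i. c i \<in> nlists n A) \<and> dbsc_converges_to L U n c p))) \<and>
   (eventually_nip L U A \<longleftrightarrow> (\<forall>n. \<forall>p\<in>types L U (carr U) n. fin_sat U A n p \<longrightarrow>
      (\<exists>d. morley_sequence L U A n p d \<and> tp_convergent L U n d)))"
proof -
  have "(\<exists>c. (\<forall>i. c i \<in> nlists n A) \<and> dbsc_converges_to L U n c p) \<longleftrightarrow>
      (\<exists>d. morley_sequence L U A n p d \<and> tp_convergent L U n d)" (is "?dbsc \<longleftrightarrow> ?conv")
    and "eventually_nip L U A \<Longrightarrow> \<exists>d. morley_sequence L U A n p d \<and> tp_convergent L U n d"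
    if p: "p \<in> types L U (carr U) n" "fin_sat U A n p" for n p
  proof -
    interpret fs_type L U A n p
      by unfold_locales (rule p)+
    obtain d where d: "morley_sequence L U A n p d" using morley_exists by blast
    interpret D: fs_type_morley L U A n p d
      by unfold_locales (rule d)
    show "?dbsc \<longleftrightarrow> ?conv"
    proof
      assume ?dbsc
      then show ?conv using d D.dbsc_imp_convergent by blast
    next
      assume ?conv
      then obtain d' where d': "morley_sequence L U A n p d'" "tp_convergent L U n d'" by blast
      interpret D': fs_type_morley L U A n p d'
        by unfold_locales (rule d')
      show ?dbsc using D'.convergent_imp_dbsc[OF d'(2)] .
    qed
    show ?conv if "eventually_nip L U A"
      using d D.eventually_nip_imp_convergent[OF that] by blast
  qed
  then show ?thesis using convergent_imp_eventually_nip by metis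
qed

theorem theorem3p6:
  fixes L :: "('f, 'r) lang"
    and T :: "('f, 'r, 'u) fm set"
    and \<kappa> :: "'k rel"
    and U M :: "('f, 'r, 'u) struct"
  assumes "countable_lang L"
    and "complete_theory L T"
    and "monster_model \<kappa> L T U"
    and "models L M T"
    and "countable (carr M)"
    and "elementary_substructure L M U"
  shows "(eventually_nip L U (carr M) \<longleftrightarrow>
            (\<forall>n. \<forall>p\<in>types L U (carr U) n. fin_sat U (carr M) n p \<longrightarrow>
               (\<exists>c. (\<forall>i. c i \<in> nlists n (carr M)) \<and> dbsc_converges_to L U n c p)))
       \<and> (eventually_nip L U (carr M) \<longleftrightarrow>
            (\<forall>n. \<forall>p\<in>types L U (carr U) n. fin_sat U (carr M) n p \<longrightarrow>
               (\<exists>d. morley_sequence L U (carr M) n p d \<and> tp_convergent L U n d)))"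
proof -
  have U: "is_struct L U" "saturated \<kappa> L U" "natLeq <o \<kappa>"
    using assms(3) by (auto simp: monster_model_def models_def)
  have M: "carr M \<subseteq> carr U" "carr M \<noteq> {}"
    using assms(6) by (auto simp: elementary_substructure_def substructure_def is_struct_def)
  interpret countable_subset L U "carr M"
  proof
    fix B n \<Gamma>
    assume B: "B \<subseteq> carr U" "countable B" "\<Gamma> \<subseteq> form L B n" "fin_sat U (carr U) n \<Gamma>"
    \<comment> \<open>A countable set has cardinality at most that of the natural numbers, which
      lies strictly below \<open>\<kappa>\<close>.\<close>
    have "|B| <o \<kappa>"
      using B(2) U(3) countable_card_le_natLeq ordLeq_ordLess_trans by blast
    then show "\<exists>as\<in>nlists n (carr U). \<forall>\<phi>\<in>\<Gamma>. holds U \<phi> as"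
      using U(2) B unfolding saturated_def by blast
  qed (use assms(1,5) U(1) M in auto)
  show ?thesis by (rule equivalences)
qed

end
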